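(* There exists $\theta>0$ such that for all reals $0<c_1<c_2$ there is a constant $\kappa>0$ (depending only on $c_1,c_2$) with the following property. For every prime $p$ and all $A,B\subset\mathbb{F}_p^*$ with $|A|,|B|\le p^{1/2-1/400}$ and $c_1|B|<|A|<c_2|B|$, with $f(x,y)=xy(x+y)$, one has $$\max\big(|f(A,B)|,\,|A\cdot B|\big)\ge\kappa|A|^{1+\theta}.$$
   Context: $\mathbb{F}_p$ is the field with $p$ elements and $\mathbb{F}_p^*=\mathbb{F}_p\setminus\{0\}$. $f(A,B)=\{f(a,b): (a,b)\in A\times B\}$ and $A\cdot B=\{ab: a\in A,\ b\in B\}$. *)

theory Defs
  imports Complex_Main "HOL-Number_Theory.Residues"
begin

text \<open>The elements of \<open>Fp p\<close> are the integers \<open>0, \<dots>, p - 1\<close>. A field type would not allow \<open>p\<close> to be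
  quantified inside the choice of the constants.\<close>

abbreviation Fp :: "nat \<Rightarrow> int ring" where
  "Fp p \<equiv> residue_ring (int p)"

abbreviation Fp_star :: "nat \<Rightarrow> int set" where
  "Fp_star p \<equiv> carrier (Fp p) - {\<zero>\<^bsub>Fp p\<^esub>}"

definition poly_f :: "('a, 'b) ring_scheme \<Rightarrow> 'a \<Rightarrow> 'a \<Rightarrow> 'a" where
  "poly_f R x y = x \<otimes>\<^bsub>R\<^esub> y \<otimes>\<^bsub>R\<^esub> (x \<oplus>\<^bsub>R\<^esub> y)"

definition image2 :: "('a \<Rightarrow> 'b \<Rightarrow> 'c) \<Rightarrow> 'a set \<Rightarrow> 'b set \<Rightarrow> 'c set" where
  "image2 g A B = {g a b | a b. a \<in> A \<and> b \<in> B}"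

end

theory Submission
  imports Defs "HOL-Analysis.Convex"
begin

text \<open>
  Write \<open>N = |A|\<close> and suppose that \<open>A B\<close> and \<open>f(A, B)\<close> have at most \<open>K N\<close> elements, where \<open>K\<close> is a
  small power of \<open>N\<close>. The proof manufactures from \<open>A\<close> a large subset that has few differences and
  few products, and then shows that the prime field has no such sets of size below \<open>\<surd>p\<close>. All losses
  are polynomial in \<open>K\<close>; since any positive exponent is allowed, none of them is optimised.

  \<^emph>\<open>From the polynomial to additive structure.\<close> A popular nonzero value \<open>c\<close> of \<open>f\<close> is attained at about
  \<open>N/K\<close> pairs \<open>(a, b)\<close>, and for such a pair \<open>a + b = c/(ab)\<close>. Dividing by \<open>a\<close>, the ratio \<open>t = b/a\<close>
  satisfies \<open>1 + t = c/(a\<^sup>2 b)\<close>, and each \<open>t\<close> comes from at most three pairs because \<open>t\<close> and \<open>c\<close>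
  determine \<open>a\<^sup>3\<close>. So there is a set \<open>T\<close> of about \<open>N/K\<close> ratios such that, for \<open>u\<close> in \<open>A\<close> and \<open>t\<close> in
  \<open>T\<close>, the element \<open>u t\<close> lies in \<open>A B / A\<close> while \<open>u + u t\<close> lies in \<open>c A / (A A B)\<close>. Both of these
  sets are small: they are controlled by \<open>|A A B / A|\<close>, which is at most \<open>K\<^sup>5 N\<close> by Petridis' form of
  the Pluennecke inequality (lemmas \<open>petridis\<close>, \<open>card_quot_set_le\<close>). Joining \<open>u\<close> to \<open>u t\<close> thus gives a
  dense bipartite graph along which there are few sums, and the Balog-Szemeredi-Gowers theorem (lemma
  \<open>balog_szemeredi_gowers\<close>) yields a large \<open>H \<subseteq> A\<close> with few differences. It has few products
  because \<open>A\<close> has.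

  \<^emph>\<open>Sum-product.\<close> By multiplicative energy, many dilates \<open>a H\<close> have a large intersection with one
  dilate \<open>e H\<close>; let \<open>H1\<close> be the set of these \<open>a\<close>. For additive purposes each such \<open>a H\<close> can be exchanged
  for \<open>e H\<close>, so a combination of boundedly many dilates of \<open>H\<close> by elements of \<open>H1\<close> is not much
  larger than \<open>H\<close>. But by the pivot argument some combination
  \<open>(c - d) x + ((a - b) + (c - d)) y\<close> with \<open>a, b, c, d \<in> H1\<close> takes about \<open>|H1|\<^sup>2\<close> values as \<open>x, y\<close>
  run over \<open>H1\<close>: either the set of quotients \<open>(a - b)/(c - d)\<close> is not closed under adding \<open>1\<close>, and a
  quotient \<open>\<xi>\<close> for which \<open>\<xi> + 1\<close> is not a quotient gives distinct values, or that set is the whole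
  prime field, and an average over the field does it. Hence \<open>|H|\<close> is bounded by a power of \<open>K\<close>
  (lemma \<open>sum_product\<close>), and then so is \<open>N\<close> (lemma \<open>card_le_expander\<close>).
\<close>

section \<open>Product sets in commutative groups\<close>

text \<open>In \<open>add_monoid R\<close> this is the difference set \<open>A - B\<close>.\<close>

definition quot_set :: "('a, 'b) monoid_scheme \<Rightarrow> 'a set \<Rightarrow> 'a set \<Rightarrow> 'a set" where
  "quot_set G A B = {a \<otimes>\<^bsub>G\<^esub> inv\<^bsub>G\<^esub> b | a b. a \<in> A \<and> b \<in> B}"

lemma set_mult_image: "A <#>\<^bsub>G\<^esub> B = (\<lambda>(a, b). a \<otimes>\<^bsub>G\<^esub> b) ` (A \<times> B)"
  by (auto simp: set_mult_def)

lemma quot_set_image: "quot_set G A B = (\<lambda>(a, b). a \<otimes>\<^bsub>G\<^esub> inv\<^bsub>G\<^esub> b) ` (A \<times> B)"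
  by (auto simp: quot_set_def)

lemma finite_set_mult [intro, simp]: "finite A \<Longrightarrow> finite B \<Longrightarrow> finite (A <#>\<^bsub>G\<^esub> B)"
  by (simp add: set_mult_image)

lemma finite_quot_set [intro, simp]: "finite A \<Longrightarrow> finite B \<Longrightarrow> finite (quot_set G A B)"
  by (simp add: quot_set_image)

lemma (in group) quot_set_closed:
  "A \<subseteq> carrier G \<Longrightarrow> B \<subseteq> carrier G \<Longrightarrow> quot_set G A B \<subseteq> carrier G"
  by (auto simp: quot_set_def)

lemma quot_set_choice:
  obtains f g where "\<And>d. d \<in> quot_set G P Q \<Longrightarrow> f d \<in> P" "\<And>d. d \<in> quot_set G P Q \<Longrightarrow> g d \<in> Q"
    "\<And>d. d \<in> quot_set G P Q \<Longrightarrow> f d \<otimes>\<^bsub>G\<^esub> inv\<^bsub>G\<^esub> (g d) = d"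
proof -
  have "\<forall>d\<in>quot_set G P Q. \<exists>ab. fst ab \<in> P \<and> snd ab \<in> Q \<and> d = fst ab \<otimes>\<^bsub>G\<^esub> inv\<^bsub>G\<^esub> (snd ab)"
    by (auto simp: quot_set_def)
  then obtain r where "\<And>d. d \<in> quot_set G P Q \<Longrightarrow>
      fst (r d) \<in> P \<and> snd (r d) \<in> Q \<and> d = fst (r d) \<otimes>\<^bsub>G\<^esub> inv\<^bsub>G\<^esub> (snd (r d))"
    by metis
  then show thesis
    using that[of "\<lambda>d. fst (r d)" "\<lambda>d. snd (r d)"] by metis
qed

context comm_group
begin

lemma mult_inv_cancel_right:
  assumes "a \<in> carrier G" "b \<in> carrier G" "c \<in> carrier G"
  shows "a \<otimes> c \<otimes> inv (b \<otimes> c) = a \<otimes> inv b"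
proof -
  have "c \<otimes> (inv c \<otimes> u) = u" if "u \<in> carrier G" for u
    using assms that by (simp flip: m_assoc)
  note canc = this
  show ?thesis
    using assms by (simp add: inv_mult m_ac canc)
qed

lemma set_mult_comm:
  assumes "A \<subseteq> carrier G" "B \<subseteq> carrier G"
  shows "A <#> B = B <#> A"
  using assms by (auto simp: set_mult_def) (metis m_comm subsetD)+

lemma card_le_card_set_mult:
  assumes "A \<subseteq> carrier G" "B \<subseteq> carrier G" "finite A" "finite B" "B \<noteq> {}"
  shows "card A \<le> card (A <#> B)"
proof -
  obtain b where b: "b \<in> B" using assms by auto
  have "inj_on (\<lambda>a. a \<otimes> b) A"
    using assms b by (auto simp: inj_on_def subset_iff)
  moreover have "(\<lambda>a. a \<otimes> b) ` A \<subseteq> A <#> B"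
    using b by (auto simp: set_mult_def)
  ultimately show ?thesis
    using assms by (auto intro: card_inj_on_le)
qed

text \<open>Fix a representation \<open>d = p/q\<close> for every quotient \<open>d\<close>. Then \<open>(d, w)\<close> is recovered from
  \<open>(p w, q w)\<close>, as the ratio of the two entries is \<open>d\<close>.\<close>

lemma ruzsa_triangle:
  assumes "P \<subseteq> carrier G" "Q \<subseteq> carrier G" "W \<subseteq> carrier G" "finite P" "finite Q" "finite W"
  shows "card (quot_set G P Q) * card W \<le> card (P <#> W) * card (Q <#> W)"
proof -
  obtain f g where f: "\<And>d. d \<in> quot_set G P Q \<Longrightarrow> f d \<in> P" and g: "\<And>d. d \<in> quot_set G P Q \<Longrightarrow> g d \<in> Q"
    and fg: "\<And>d. d \<in> quot_set G P Q \<Longrightarrow> f d \<otimes> inv (g d) = d"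
    by (rule quot_set_choice[of G P Q]) (rule that; blast)
  let ?F = "\<lambda>(d, w). (f d \<otimes> w, g d \<otimes> w)"
  have rec: "f d \<otimes> w \<otimes> inv (g d \<otimes> w) = d" if "d \<in> quot_set G P Q" "w \<in> W" for d w
    using mult_inv_cancel_right[of "f d" "g d" w] f[OF that(1)] g[OF that(1)] fg[OF that(1)] that assms
    by auto
  have "inj_on ?F (quot_set G P Q \<times> W)"
  proof (rule inj_onI, clarify)
    fix d w d' w'
    assume dw: "d \<in> quot_set G P Q" "w \<in> W" "d' \<in> quot_set G P Q" "w' \<in> W"
      and eq: "f d \<otimes> w = f d' \<otimes> w'" "g d \<otimes> w = g d' \<otimes> w'"
    have "d = d'"
      using rec[OF dw(1,2)] rec[OF dw(3,4)] eq by simp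
    moreover have "w = w'"
      using eq(1) f[OF dw(1)] dw assms unfolding \<open>d = d'\<close> by (metis Units_eq Units_l_cancel subsetD)
    ultimately show "d = d' \<and> w = w'" by simp
  qed
  moreover have "?F ` (quot_set G P Q \<times> W) \<subseteq> (P <#> W) \<times> (Q <#> W)"
    using f g by (auto simp: set_mult_def)
  ultimately have "card (quot_set G P Q \<times> W) \<le> card ((P <#> W) \<times> (Q <#> W))"
    using assms by (intro card_inj_on_le) auto
  then show ?thesis
    by (simp add: card_cartesian_product)
qed

text \<open>\<open>X\<close> is the subset of \<open>A\<close> that minimises \<open>|X B| / |X|\<close>. The inequality is proved by adding the
  elements of \<open>Z\<close> one at a time. A new element \<open>z\<close> adds to \<open>X B Z\<close> only points of \<open>x B z\<close> for those \<open>x\<close>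
  whose \<open>x B z\<close> is not yet covered; the other \<open>x\<close> form a set \<open>Y\<close>, and minimality bounds \<open>|Y B|\<close> from
  below. It adds to \<open>X Z\<close> a point for each \<open>x\<close> outside a set \<open>W\<close> that is contained in \<open>Y\<close>.\<close>

lemma petridis:
  assumes A: "A \<subseteq> carrier G" "finite A" "A \<noteq> {}" and B: "B \<subseteq> carrier G" "finite B"
    and K: "real (card (A <#> B)) \<le> K * real (card A)"
  obtains X where "X \<subseteq> A" "X \<noteq> {}"
    "\<And>Z. Z \<subseteq> carrier G \<Longrightarrow> finite Z \<Longrightarrow> real (card (X <#> B <#> Z)) \<le> K * real (card (X <#> Z))"
proof -
  define \<rho> where "\<rho> Y = real (card (Y <#> B)) / real (card Y)" for Y
  have "finite (Pow A - {{}})" "Pow A - {{}} \<noteq> {}" using A by auto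
  then obtain X where "is_arg_min \<rho> (\<lambda>Y. Y \<in> Pow A - {{}}) X"
    using ex_is_arg_min_if_finite by blast
  then have X: "X \<subseteq> A" "X \<noteq> {}" and X_min: "\<And>Y. Y \<subseteq> A \<Longrightarrow> Y \<noteq> {} \<Longrightarrow> \<rho> X \<le> \<rho> Y"
    by (force simp: is_arg_min_linorder)+
  have finX: "finite X" and carX: "X \<subseteq> carrier G"
    using X A finite_subset by auto
  have posX: "card X > 0" using X finX by (simp add: card_gt_0_iff)
  have XB: "real (card (X <#> B)) = \<rho> X * real (card X)"
    using posX by (simp add: \<rho>_def)
  have \<rho>0: "\<rho> X \<ge> 0" by (simp add: \<rho>_def)
  have \<rho>K: "\<rho> X \<le> K"
  proof -
    have "\<rho> A \<le> K" using K A by (simp add: \<rho>_def divide_le_eq card_gt_0_iff)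
    then show ?thesis using X_min[of A] A by simp
  qed
  have sub_min: "\<rho> X * real (card Y) \<le> real (card (Y <#> B))" if "Y \<subseteq> X" for Y
  proof (cases "Y = {}")
    case False
    then have "card Y > 0" using that finX finite_subset card_gt_0_iff by blast
    then show ?thesis
      using X_min[of Y] False that X by (simp add: \<rho>_def le_divide_eq)
  qed simp
  have main: "real (card (X <#> B <#> Z)) \<le> \<rho> X * real (card (X <#> Z))"
    if "finite Z" "Z \<subseteq> carrier G" for Z
    using that
  proof (induction rule: finite_induct)
    case empty
    then show ?case by (simp add: set_mult_def)
  next
    case (insert z Z)
    have z: "z \<in> carrier G" and Z: "Z \<subseteq> carrier G" using insert.prems by auto
    define Y where "Y = {x \<in> X. \<forall>b\<in>B. x \<otimes> b \<otimes> z \<in> X <#> B <#> Z}"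
    define W where "W = {x \<in> X. x \<otimes> z \<in> X <#> Z}"
    have "W \<subseteq> Y"
    proof
      fix x assume "x \<in> W"
      then obtain x' z' where x: "x \<in> X" "x' \<in> X" "z' \<in> Z" "x \<otimes> z = x' \<otimes> z'"
        by (auto simp: W_def set_mult_def)
      have "x \<otimes> b \<otimes> z = x' \<otimes> b \<otimes> z'" if "b \<in> B" for b
      proof -
        have c: "x \<in> carrier G" "x' \<in> carrier G" "z' \<in> carrier G" "b \<in> carrier G"
          using x that carX Z B by auto
        have "x \<otimes> b \<otimes> z = b \<otimes> (x \<otimes> z)" using c z by (simp add: m_ac)
        also have "\<dots> = x' \<otimes> b \<otimes> z'" using c by (simp add: x(4) m_ac)
        finally show ?thesis .
      qed
      then show "x \<in> Y" using x by (force simp: Y_def set_mult_def)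
    qed
    have inj: "inj_on (\<lambda>u. u \<otimes> z) S" if "S \<subseteq> carrier G" for S
      using that z by (auto simp: inj_on_def subset_iff)
    have finY: "finite Y" and finW: "finite W" using finX by (auto simp: Y_def W_def)
    have YX: "Y \<subseteq> X" and WX: "W \<subseteq> X" by (auto simp: Y_def W_def)
    have carXB: "X <#> B \<subseteq> carrier G" using carX B by (simp add: set_mult_closed)
    have card_up: "card (X <#> B <#> insert z Z) + card (Y <#> B) \<le> card (X <#> B <#> Z) + card (X <#> B)"
    proof -
      have "X <#> B <#> insert z Z \<subseteq> (X <#> B <#> Z) \<union> (\<lambda>u. u \<otimes> z) ` ((X <#> B) - (Y <#> B))"
      proof
        fix v assume "v \<in> X <#> B <#> insert z Z"
        then obtain u z' where v: "v = u \<otimes> z'" "u \<in> X <#> B" "z' \<in> insert z Z"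
          by (auto simp: set_mult_def)
        show "v \<in> (X <#> B <#> Z) \<union> (\<lambda>u. u \<otimes> z) ` ((X <#> B) - (Y <#> B))"
        proof (cases "z' \<in> Z \<or> u \<in> Y <#> B")
          case True
          then show ?thesis using v by (auto simp: Y_def set_mult_def)
        qed (use v in auto)
      qed
      then have "card (X <#> B <#> insert z Z)
          \<le> card ((X <#> B <#> Z) \<union> (\<lambda>u. u \<otimes> z) ` ((X <#> B) - (Y <#> B)))"
        using finX B insert.hyps by (intro card_mono) auto
      also have "\<dots> \<le> card (X <#> B <#> Z) + card ((\<lambda>u. u \<otimes> z) ` ((X <#> B) - (Y <#> B)))"
        by (rule card_Un_le)
      also have "card ((\<lambda>u. u \<otimes> z) ` ((X <#> B) - (Y <#> B))) = card ((X <#> B) - (Y <#> B))"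
        using carXB by (intro card_image inj) auto
      also have "card ((X <#> B) - (Y <#> B)) = card (X <#> B) - card (Y <#> B)"
        using finY B mono_set_mult[OF YX order_refl, of G B] by (intro card_Diff_subset) auto
      finally show ?thesis
        using card_mono[OF _ mono_set_mult[OF YX order_refl, of G B]] finX B by simp
    qed
    have card_low: "card (X <#> insert z Z) + card W = card (X <#> Z) + card X"
    proof -
      have "X <#> insert z Z = (X <#> Z) \<union> (\<lambda>u. u \<otimes> z) ` (X - W)"
        by (auto simp: set_mult_def W_def)
      moreover have "(X <#> Z) \<inter> (\<lambda>u. u \<otimes> z) ` (X - W) = {}"
        by (auto simp: W_def)
      ultimately have "card (X <#> insert z Z) = card (X <#> Z) + card ((\<lambda>u. u \<otimes> z) ` (X - W))"
        using finX insert.hyps by (simp add: card_Un_disjoint)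
      also have "card ((\<lambda>u. u \<otimes> z) ` (X - W)) = card (X - W)"
        using carX by (intro card_image inj) auto
      also have "card (X - W) = card X - card W"
        using finW WX by (rule card_Diff_subset)
      finally show ?thesis
        using card_mono[OF finX WX] by simp
    qed
    have "real (card (X <#> B <#> insert z Z))
        \<le> real (card (X <#> B <#> Z)) + real (card (X <#> B)) - real (card (Y <#> B))"
      using card_up by linarith
    also have "\<dots> \<le> \<rho> X * real (card (X <#> Z)) + \<rho> X * real (card X) - \<rho> X * real (card Y)"
      using insert.IH[OF Z] XB sub_min[OF YX] by linarith
    also have "\<dots> \<le> \<rho> X * real (card (X <#> Z)) + \<rho> X * real (card X) - \<rho> X * real (card W)"
      using card_mono[OF finY \<open>W \<subseteq> Y\<close>] \<rho>0 by (simp add: mult_left_mono)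
    also have "\<dots> = \<rho> X * real (card (X <#> insert z Z))"
    proof -
      have "real (card (X <#> insert z Z)) = real (card (X <#> Z)) + real (card X) - real (card W)"
        using card_low by linarith
      then show ?thesis by (simp only: distrib_left right_diff_distrib)
    qed
    finally show ?case .
  qed
  show ?thesis
  proof (rule that[OF X])
    fix Z assume "Z \<subseteq> carrier G" "finite Z"
    then have "real (card (X <#> B <#> Z)) \<le> \<rho> X * real (card (X <#> Z))"
      by (intro main)
    also have "\<dots> \<le> K * real (card (X <#> Z))"
      using \<rho>K by (simp add: mult_right_mono)
    finally show "real (card (X <#> B <#> Z)) \<le> K * real (card (X <#> Z))" .
  qed
qed

lemma quot_set_eq_set_mult: "quot_set G A B = A <#> (\<lambda>b. inv b) ` B"
  by (auto simp: quot_set_def set_mult_def)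

lemma inv_image_closed: "A \<subseteq> carrier G \<Longrightarrow> (\<lambda>a. inv a) ` A \<subseteq> carrier G"
  by auto

lemma inv_image_inv_image: "A \<subseteq> carrier G \<Longrightarrow> (\<lambda>a. inv a) ` (\<lambda>a. inv a) ` A = A"
  by (subst image_image, subst image_cong[OF refl, of A _ "\<lambda>a. a"]) auto

lemma card_inv_image: "A \<subseteq> carrier G \<Longrightarrow> card ((\<lambda>a. inv a) ` A) = card A"
  by (intro card_image inj_onI) (metis inv_inv subsetD)

text \<open>Two applications of \<open>petridis\<close>, one to \<open>A\<close> and one to \<open>B\<close>, give sets \<open>X \<subseteq> A\<close> and
  \<open>Y \<subseteq> B\<close>. The first bounds \<open>B B\<close>, the second bounds \<open>A A B Y\<close> in terms of \<open>B B\<close> and also \<open>A Y\<close>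
  in terms of \<open>Y\<close>. The triangle inequality with pivot \<open>Y\<close> puts these together, and the unknown size of \<open>Y\<close>
  cancels. This one quotient set dominates all the product sets that the main argument meets.\<close>

lemma card_quot_set_le:
  assumes A: "A \<subseteq> carrier G" "finite A" "A \<noteq> {}" and B: "B \<subseteq> carrier G" "finite B" "B \<noteq> {}"
    and K1: "real (card (A <#> B)) \<le> K * real (card A)"
    and K2: "real (card (A <#> B)) \<le> K * real (card B)"
  shows "real (card (quot_set G (A <#> A <#> B) A)) \<le> K ^ 5 * real (card A)"
proof -
  note cl = set_mult_closed and as = set_mult_assoc and fin = finite_set_mult
  have "0 < card A" using A by (simp add: card_gt_0_iff)
  then have K0: "K \<ge> 0"
    using order_trans[OF of_nat_0_le_iff K1] by (simp add: zero_le_mult_iff)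
  obtain X where X: "X \<subseteq> A" "X \<noteq> {}" and X_le:
    "\<And>Z. Z \<subseteq> carrier G \<Longrightarrow> finite Z \<Longrightarrow> real (card (X <#> B <#> Z)) \<le> K * real (card (X <#> Z))"
    using petridis[OF A B(1,2) K1] by metis
  have "real (card (B <#> A)) \<le> K * real (card B)"
    using K2 set_mult_comm[OF A(1) B(1)] by simp
  then obtain Y where Y: "Y \<subseteq> B" "Y \<noteq> {}" and Y_le:
    "\<And>Z. Z \<subseteq> carrier G \<Longrightarrow> finite Z \<Longrightarrow> real (card (Y <#> A <#> Z)) \<le> K * real (card (Y <#> Z))"
    using petridis[OF B A(1,2)] by metis
  have Xc: "X \<subseteq> carrier G" "finite X" and Yc: "Y \<subseteq> carrier G" "finite Y"
    using X(1) Y(1) A(1,2) B(1,2) by (auto intro: finite_subset)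
  have one: "S <#> {\<one>} = S" if "S \<subseteq> carrier G" for S
    using that by (force simp: set_mult_def)
  have BB: "real (card (B <#> B)) \<le> K ^ 2 * real (card A)"
  proof -
    have "card (B <#> B) \<le> card (B <#> B <#> X)"
      using B X Xc by (intro card_le_card_set_mult cl fin) auto
    also have "B <#> B <#> X = X <#> B <#> B"
      using B Xc set_mult_comm[of "B <#> B" X] as[of X B B] by (simp add: cl)
    finally have "real (card (B <#> B)) \<le> real (card (X <#> B <#> B))" by simp
    also have "\<dots> \<le> K * real (card (X <#> B))" using X_le B by simp
    also have "\<dots> \<le> K * (K * real (card X))"
      using X_le[of "{\<one>}"] K0 Xc B by (intro mult_left_mono) (simp_all add: one cl)
    also have "\<dots> \<le> K * (K * real (card A))"
      using K0 X A by (intro mult_left_mono) (simp_all add: card_mono)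
    finally show ?thesis by (simp add: power2_eq_square mult.assoc)
  qed
  have AABY: "real (card (A <#> A <#> B <#> Y)) \<le> K ^ 4 * real (card A)"
  proof -
    have "A <#> A <#> B <#> Y = Y <#> A <#> (A <#> B)"
      using A B Yc set_mult_comm[of "A <#> A <#> B" Y] as[of A A B] as[of Y A "A <#> B"]
      by (simp add: cl)
    then have "real (card (A <#> A <#> B <#> Y)) \<le> K * real (card (Y <#> (A <#> B)))"
      using Y_le[of "A <#> B"] A B by (simp add: cl)
    also have "Y <#> (A <#> B) = Y <#> A <#> B" using as[of Y A B] A B Yc by simp
    also have "K * real (card (Y <#> A <#> B)) \<le> K * (K * real (card (Y <#> B)))"
      using Y_le[of B] B K0 by (intro mult_left_mono) auto
    also have "\<dots> \<le> K * (K * real (card (B <#> B)))"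
      using K0 Y B mono_set_mult[OF Y(1) order_refl, of G B]
      by (intro mult_left_mono) (simp_all add: card_mono)
    also have "\<dots> \<le> K * (K * (K ^ 2 * real (card A)))"
      using K0 BB by (intro mult_left_mono) auto
    finally show ?thesis by (simp add: power_def numeral_eq_Suc mult.assoc)
  qed
  have AY: "real (card (A <#> Y)) \<le> K * real (card Y)"
    using Y_le[of "{\<one>}"] Yc A set_mult_comm[of A Y] by (simp add: one cl)
  have "card (quot_set G (A <#> A <#> B) A) * card Y
      \<le> card (A <#> A <#> B <#> Y) * card (A <#> Y)"
    using A B Yc by (intro ruzsa_triangle cl fin) auto
  then have "real (card (quot_set G (A <#> A <#> B) A)) * real (card Y)
      \<le> real (card (A <#> A <#> B <#> Y)) * real (card (A <#> Y))"
    by (metis of_nat_le_iff of_nat_mult)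
  also have "\<dots> \<le> (K ^ 4 * real (card A)) * (K * real (card Y))"
    using K0 by (intro mult_mono AABY AY) auto
  also have "\<dots> = (K ^ 5 * real (card A)) * real (card Y)"
    by (simp add: numeral_eq_Suc)
  finally show ?thesis
    using Y Yc by (simp add: card_gt_0_iff)
qed

text \<open>Petridis' lemma for \<open>A = H\<^sup>-\<^sup>1\<close> and \<open>B = H\<close> bounds each further multiplication by \<open>H\<close> by a factor
  \<open>L\<close>.\<close>

lemma card_fourfold_le:
  assumes H: "H \<subseteq> carrier G" "finite H" "H \<noteq> {}"
    and L: "real (card (quot_set G H H)) \<le> L * real (card H)"
  shows "real (card (H <#> H <#> H <#> H)) \<le> L ^ 4 * real (card H)"
proof -
  let ?I = "(\<lambda>h. inv h) ` H"
  have "0 < card H" using H by (simp add: card_gt_0_iff)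
  then have L0: "L \<ge> 0"
    using order_trans[OF of_nat_0_le_iff L] by (simp add: zero_le_mult_iff)
  have I: "?I \<subseteq> carrier G" "finite ?I" "?I \<noteq> {}" and cardI: "card ?I = card H"
    using H inv_image_closed card_inv_image by auto
  have "real (card (?I <#> H)) \<le> L * real (card ?I)"
    using L set_mult_comm[OF H(1) I(1)] cardI by (simp add: quot_set_eq_set_mult)
  then obtain X where X: "X \<subseteq> ?I" "X \<noteq> {}" and X_le:
    "\<And>Z. Z \<subseteq> carrier G \<Longrightarrow> finite Z \<Longrightarrow> real (card (X <#> H <#> Z)) \<le> L * real (card (X <#> Z))"
    using petridis[OF I H(1,2)] by metis
  have Xc: "X \<subseteq> carrier G" "finite X" using X I finite_subset by (blast, blast)
  have step: "real (card (X <#> (H <#> Z))) \<le> L * real (card (X <#> Z))"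
    if "Z \<subseteq> carrier G" "finite Z" for Z
    using X_le[OF that] that H Xc by (simp add: set_mult_assoc)
  let ?H2 = "H <#> H" let ?H3 = "H <#> ?H2" let ?H4 = "H <#> ?H3"
  have c: "?H2 \<subseteq> carrier G" "?H3 \<subseteq> carrier G" "?H4 \<subseteq> carrier G"
    using H by (simp_all add: set_mult_closed)
  have one: "S <#> {\<one>} = S" if "S \<subseteq> carrier G" for S
    using that by (force simp: set_mult_def)
  have "card ?H4 \<le> card (?H4 <#> X)"
    using c H Xc X by (intro card_le_card_set_mult) auto
  then have "real (card ?H4) \<le> real (card (X <#> ?H4))"
    using set_mult_comm[OF c(3) Xc(1)] by simp
  also have "\<dots> \<le> L * real (card (X <#> ?H3))" using step[of ?H3] c H by auto
  also have "\<dots> \<le> L * (L * real (card (X <#> ?H2)))"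
    using step[of ?H2] c H L0 by (intro mult_left_mono) auto
  also have "\<dots> \<le> L * (L * (L * real (card (X <#> H))))"
    using step[of H] H L0 by (intro mult_left_mono) auto
  also have "\<dots> \<le> L * (L * (L * (L * real (card X))))"
    using step[of "{\<one>}"] H Xc L0 by (intro mult_left_mono) (auto simp: one)
  also have "\<dots> \<le> L * (L * (L * (L * real (card ?I))))"
    using card_mono[OF I(2) X(1)] L0 by (intro mult_left_mono) auto
  also have "\<dots> = L ^ 4 * real (card H)"
    using cardI by (simp add: numeral_eq_Suc)
  also have "?H4 = H <#> H <#> H <#> H" using H by (simp add: set_mult_assoc set_mult_closed)
  finally show ?thesis .
qed

text \<open>If \<open>S\<close> has few quotients and meets \<open>S'\<close> in a large set, then \<open>S\<close> may be replaced by \<open>S'\<close> in any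
  product. This is the triangle inequality for \<open>P\<close> and \<open>S\<^sup>-\<^sup>1\<close> with pivot \<open>S \<inter> S'\<close>.\<close>

lemma card_set_mult_exchange:
  assumes P: "P \<subseteq> carrier G" "finite P" and S: "S \<subseteq> carrier G" "finite S"
    and S': "S' \<subseteq> carrier G" "finite S'"
  shows "card (P <#> S) * card (S \<inter> S') \<le> card (P <#> S') * card (quot_set G S S)"
proof -
  let ?Q = "(\<lambda>s. inv s) ` S"
  have Q: "?Q \<subseteq> carrier G" using S(1) by (rule inv_image_closed)
  have "card (quot_set G P ?Q) * card (S \<inter> S') \<le> card (P <#> (S \<inter> S')) * card (?Q <#> (S \<inter> S'))"
    using P S Q by (intro ruzsa_triangle) auto
  also have "quot_set G P ?Q = P <#> S"
    by (simp only: quot_set_eq_set_mult inv_image_inv_image[OF S(1)])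
  also have "card (P <#> (S \<inter> S')) * card (?Q <#> (S \<inter> S')) \<le> card (P <#> S') * card (?Q <#> S)"
    by (rule mult_le_mono; rule card_mono[OF _ mono_set_mult]) (use P S S' in auto)
  also have "?Q <#> S = quot_set G S S"
    by (simp only: quot_set_eq_set_mult set_mult_comm[OF Q S(1)])
  finally show ?thesis .
qed

end

section \<open>Collisions and paths in dense bipartite graphs\<close>

lemma card_collisions_eq:
  assumes "finite Z"
  shows "card {(z, z'). z \<in> Z \<and> z' \<in> Z \<and> g z = g z'} = (\<Sum>y\<in>g ` Z. (card {z \<in> Z. g z = y})\<^sup>2)"
proof -
  have "{(z, z'). z \<in> Z \<and> z' \<in> Z \<and> g z = g z'}
      = (\<Union>y\<in>g ` Z. {z \<in> Z. g z = y} \<times> {z \<in> Z. g z = y})"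
    by auto
  then show ?thesis
    using assms
    by (simp only:, subst card_UN_disjoint) (auto simp: card_cartesian_product power2_eq_square)
qed

lemma card_eq_sum_fibres:
  assumes "finite Z"
  shows "card Z = (\<Sum>y\<in>g ` Z. card {z \<in> Z. g z = y})"
  using assms sum.image_gen[of Z "\<lambda>_. 1::nat" g] by simp

text \<open>Cauchy-Schwarz for the sizes of the fibres of \<open>g\<close>.\<close>

lemma card_squared_le_collisions:
  assumes "finite Z"
  shows "(card Z)\<^sup>2 \<le> card (g ` Z) * card {(z, z'). z \<in> Z \<and> z' \<in> Z \<and> g z = g z'}"
proof -
  have "(real (card Z))\<^sup>2 = (\<Sum>y\<in>g ` Z. real (card {z \<in> Z. g z = y}))\<^sup>2"
    using card_eq_sum_fibres[OF assms, of g] by simp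
  also have "\<dots> \<le> (\<Sum>y\<in>g ` Z. (real (card {z \<in> Z. g z = y}))\<^sup>2) * real (card (g ` Z))"
    by (rule sum_squared_le_sum_of_squares)
  also have "\<dots> = real (card (g ` Z) * card {(z, z'). z \<in> Z \<and> z' \<in> Z \<and> g z = g z'})"
    by (simp add: card_collisions_eq[OF assms])
  finally show ?thesis
    by (simp flip: of_nat_power of_nat_mult)
qed

text \<open>
  A pair of vertices of \<open>U\<close> is bad if it has fewer than \<open>t = \<delta>\<^sup>2 |V| / 16\<close> common neighbours. Averaged
  over \<open>v\<close>, the neighbourhood \<open>N v\<close> contains at least \<open>\<delta>\<^sup>2 |U|\<^sup>2\<close> pairs but at most \<open>\<delta>\<^sup>2 |U|\<^sup>2 / 16\<close> bad
  ones, so some \<open>N v0\<close> is large and at most an eighth of its pairs are bad. Take for \<open>U'\<close> the vertices of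
  \<open>N v0\<close> that form a bad pair with at most a quarter of \<open>N v0\<close>. Any two of these share at least half of \<open>N v0\<close>
  as good partners \<open>w\<close>, and each \<open>w\<close> gives at least \<open>t\<^sup>2\<close> paths of length four.
\<close>

lemma dense_bipartite_paths:
  fixes E :: "'a \<Rightarrow> 'b \<Rightarrow> bool"
  assumes fin: "finite U" "finite V" and V: "V \<noteq> {}" and \<delta>: "\<delta> \<ge> 0"
    and dense: "\<delta> * real (card U) * real (card V) \<le> real (card {(u, v). u \<in> U \<and> v \<in> V \<and> E u v})"
  obtains U' where "U' \<subseteq> U" "\<delta> / 4 * real (card U) \<le> real (card U')"
    "\<And>u u'. u \<in> U' \<Longrightarrow> u' \<in> U' \<Longrightarrow> \<delta> ^ 5 / 1024 * real (card U) * (real (card V))\<^sup>2 \<le>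
      real (card {(w, v, v'). w \<in> U \<and> v \<in> V \<and> v' \<in> V \<and> E u v \<and> E w v \<and> E w v' \<and> E u' v'})"
proof -
  define N where "N v = {u \<in> U. E u v}" for v
  define C where "C u u' = {v \<in> V. E u v \<and> E u' v}" for u u'
  define t where "t = \<delta>\<^sup>2 * real (card V) / 16"
  define Bad where "Bad = {(u, u'). u \<in> U \<and> u' \<in> U \<and> real (card (C u u')) < t}"
  define bad where "bad v = {(u, u'). u \<in> N v \<and> u' \<in> N v \<and> (u, u') \<in> Bad}" for v
  define n m where "n = real (card U)" and "m = real (card V)"
  have m: "m > 0" using V fin by (simp add: m_def card_gt_0_iff)
  have n: "n \<ge> 0" by (simp add: n_def)
  have finN: "finite (N v)" for v using fin by (simp add: N_def)
  have finBad: "finite Bad"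
    by (rule finite_subset[of _ "U \<times> U"]) (use fin in \<open>auto simp: Bad_def\<close>)
  have symC: "C u u' = C u' u" for u u' by (auto simp: C_def)
  have edges: "(\<Sum>v\<in>V. real (card (N v))) = real (card {(u, v). u \<in> U \<and> v \<in> V \<and> E u v})"
  proof -
    have "{(u, v). u \<in> U \<and> v \<in> V \<and> E u v} = prod.swap ` (SIGMA v:V. N v)"
      by (auto simp: N_def)
    then have "card {(u, v). u \<in> U \<and> v \<in> V \<and> E u v} = card (SIGMA v:V. N v)"
      by (simp add: card_image)
    then show ?thesis using fin finN by simp
  qed
  have sq: "\<delta>\<^sup>2 * n\<^sup>2 * m \<le> (\<Sum>v\<in>V. (real (card (N v)))\<^sup>2)"
  proof -
    have "(\<delta> * n * m)\<^sup>2 \<le> (\<Sum>v\<in>V. real (card (N v)))\<^sup>2"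
      using dense edges \<delta> m n by (intro power_mono) (auto simp: n_def m_def)
    also have "\<dots> \<le> (\<Sum>v\<in>V. (real (card (N v)))\<^sup>2) * m"
      unfolding m_def by (rule sum_squared_le_sum_of_squares)
    finally have "(\<delta>\<^sup>2 * n\<^sup>2 * m) * m \<le> (\<Sum>v\<in>V. (real (card (N v)))\<^sup>2) * m"
      by (simp add: power2_eq_square mult_ac)
    then show ?thesis using m by simp
  qed
  have bad_sum: "(\<Sum>v\<in>V. real (card (bad v))) \<le> n\<^sup>2 * t"
  proof -
    have "(\<Sum>v\<in>V. card (bad v)) = card (SIGMA v:V. bad v)"
      using fin finN finBad
      by (subst card_SigmaI) (auto simp: bad_def intro!: finite_subset[OF _ finBad])
    also have "\<dots> = card (SIGMA b:Bad. C (fst b) (snd b))"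
    proof -
      have "(SIGMA v:V. bad v) = prod.swap ` (SIGMA b:Bad. C (fst b) (snd b))"
        by (auto simp: bad_def C_def N_def Bad_def image_iff)
      then show ?thesis by (simp add: card_image)
    qed
    also have "\<dots> = (\<Sum>b\<in>Bad. card (C (fst b) (snd b)))"
      using finBad fin by (simp add: C_def)
    finally have "(\<Sum>v\<in>V. real (card (bad v))) = (\<Sum>b\<in>Bad. real (card (C (fst b) (snd b))))"
      by (metis of_nat_sum)
    also have "\<dots> \<le> (\<Sum>b\<in>Bad. t)"
      by (intro sum_mono) (auto simp: Bad_def)
    also have "\<dots> = real (card Bad) * t" by simp
    also have "\<dots> \<le> n\<^sup>2 * t"
    proof -
      have "card Bad \<le> card (U \<times> U)"
        using fin by (intro card_mono) (auto simp: Bad_def)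
      then have "real (card Bad) \<le> n\<^sup>2"
        by (simp add: n_def power2_eq_square card_cartesian_product flip: of_nat_mult)
      then show ?thesis by (intro mult_right_mono) (simp_all add: t_def)
    qed
    finally show ?thesis .
  qed
  obtain v0 where v0: "v0 \<in> V"
    "\<delta>\<^sup>2 * n\<^sup>2 / 2 \<le> (real (card (N v0)))\<^sup>2 - 8 * real (card (bad v0))"
  proof (rule ccontr)
    assume "\<not> thesis"
    with that have "\<And>v. v \<in> V \<Longrightarrow> (real (card (N v)))\<^sup>2 - 8 * real (card (bad v)) < \<delta>\<^sup>2 * n\<^sup>2 / 2"
      by force
    then have "(\<Sum>v\<in>V. (real (card (N v)))\<^sup>2 - 8 * real (card (bad v))) < (\<Sum>v\<in>V. \<delta>\<^sup>2 * n\<^sup>2 / 2)"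
      using fin V by (intro sum_strict_mono) auto
    moreover have "(\<Sum>v\<in>V. (real (card (N v)))\<^sup>2 - 8 * real (card (bad v)))
        = (\<Sum>v\<in>V. (real (card (N v)))\<^sup>2) - 8 * (\<Sum>v\<in>V. real (card (bad v)))"
      by (simp add: sum_subtractf sum_distrib_left)
    moreover have "(\<Sum>v\<in>V. \<delta>\<^sup>2 * n\<^sup>2 / 2) = \<delta>\<^sup>2 * n\<^sup>2 * m / 2"
      by (simp add: m_def)
    moreover have "n\<^sup>2 * t = \<delta>\<^sup>2 * n\<^sup>2 * m / 16"
      by (simp add: t_def m_def)
    ultimately show False using sq bad_sum by linarith
  qed
  define d where "d = real (card (N v0))"
  have d0: "d \<ge> 0" by (simp add: d_def)
  have d_low: "\<delta> * n / 2 \<le> d"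
  proof (rule power2_le_imp_le[OF _ d0])
    have "0 \<le> \<delta>\<^sup>2 * n\<^sup>2" "0 \<le> real (card (bad v0))" by simp_all
    then have "\<delta>\<^sup>2 * n\<^sup>2 / 4 \<le> d\<^sup>2"
      using v0(2) unfolding d_def by linarith
    then show "(\<delta> * n / 2)\<^sup>2 \<le> d\<^sup>2"
      by (simp add: power_mult_distrib power_divide)
  qed
  have bad_le: "real (card (bad v0)) \<le> d\<^sup>2 / 8"
  proof -
    have "0 \<le> \<delta>\<^sup>2 * n\<^sup>2" by simp
    then show ?thesis using v0(2) unfolding d_def by linarith
  qed
  define B where "B u = {u' \<in> N v0. (u, u') \<in> Bad}" for u
  define U' where "U' = {u \<in> N v0. real (card (B u)) \<le> d / 4}"
  have finB: "finite (B u)" for u using finN by (simp add: B_def)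
  have U'N: "U' \<subseteq> N v0" by (auto simp: U'_def)
  have U'_large: "d / 2 \<le> real (card U')"
  proof (cases "d = 0")
    case False
    have "real (card (N v0 - U')) * (d / 4) = (\<Sum>u\<in>N v0 - U'. d / 4)" by simp
    also have "\<dots> \<le> (\<Sum>u\<in>N v0 - U'. real (card (B u)))"
      by (intro sum_mono) (auto simp: U'_def)
    also have "\<dots> = real (card (SIGMA u:N v0 - U'. B u))"
      using finN finB by simp
    also have "\<dots> \<le> real (card (bad v0))"
      using finN finBad
      by (intro of_nat_mono card_mono) (auto simp: bad_def B_def intro!: finite_subset[OF _ finBad])
    also have "\<dots> \<le> (d / 2) * (d / 4)" using bad_le by (simp add: power2_eq_square)
    finally have "real (card (N v0 - U')) \<le> d / 2"
      using False d0 by (simp add: divide_right_mono)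
    moreover have "real (card (N v0 - U')) = d - real (card U')"
      using card_Diff_subset[OF finite_subset[OF U'N finN] U'N] card_mono[OF finN U'N]
      by (simp add: d_def)
    ultimately show ?thesis by simp
  qed simp
  show thesis
  proof (rule that)
    show "U' \<subseteq> U" using U'N by (auto simp: N_def)
    show "\<delta> / 4 * real (card U) \<le> real (card U')"
      using U'_large d_low by (simp add: n_def)
    fix u u' assume u: "u \<in> U'" "u' \<in> U'"
    define W where "W = N v0 - B u - B u'"
    have W_large: "d / 2 \<le> real (card W)"
    proof -
      have "card (N v0) \<le> card (W \<union> (B u \<union> B u'))"
        using finN finB by (intro card_mono) (auto simp: W_def)
      also have "\<dots> \<le> card W + (card (B u) + card (B u'))"
        by (meson add_left_mono card_Un_le order_trans)
      finally show ?thesis using u by (simp add: U'_def d_def)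
    qed
    have finC: "finite (C a b)" for a b using fin by (simp add: C_def)
    have t0: "t \<ge> 0" by (simp add: t_def)
    have finP: "finite {(w, v, v'). w \<in> U \<and> v \<in> V \<and> v' \<in> V \<and> E u v \<and> E w v \<and> E w v' \<and> E u' v'}"
      by (rule finite_subset[of _ "U \<times> V \<times> V"]) (use fin in auto)
    have good: "t \<le> real (card (C u w))" "t \<le> real (card (C w u'))" if "w \<in> W" for w
      using that u U'N symC[of w u'] by (auto simp: W_def B_def Bad_def N_def)
    have "\<delta> ^ 5 / 1024 * n * m\<^sup>2 = (\<delta> * n / 2) / 2 * (t * t)"
      by (simp add: t_def m_def power2_eq_square numeral_eq_Suc)
    also have "\<dots> \<le> real (card W) * (t * t)"
      using d_low W_large t0 by (intro mult_right_mono) auto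
    also have "\<dots> = (\<Sum>w\<in>W. t * t)" by simp
    also have "\<dots> \<le> (\<Sum>w\<in>W. real (card (C u w)) * real (card (C w u')))"
      using good t0 by (intro sum_mono mult_mono) auto
    also have "\<dots> = real (card (SIGMA w:W. C u w \<times> C w u'))"
      using finN finC by (simp add: W_def card_cartesian_product)
    also have "\<dots> \<le> real (card {(w, v, v'). w \<in> U \<and> v \<in> V \<and> v' \<in> V \<and> E u v \<and> E w v \<and> E w v' \<and> E u' v'})"
      by (intro of_nat_mono card_mono[OF finP]) (auto simp: W_def C_def N_def)
    finally show "\<delta> ^ 5 / 1024 * real (card U) * (real (card V))\<^sup>2 \<le>
      real (card {(w, v, v'). w \<in> U \<and> v \<in> V \<and> v' \<in> V \<and> E u v \<and> E w v \<and> E w v' \<and> E u' v'})"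
      by (simp add: n_def m_def)
  qed
qed

context comm_group
begin

lemma mult_inv_trans:
  assumes "a \<in> carrier G" "b \<in> carrier G" "c \<in> carrier G"
  shows "(a \<otimes> inv b) \<otimes> (b \<otimes> inv c) = a \<otimes> inv c"
proof -
  have "b \<otimes> (inv b \<otimes> u) = u" if "u \<in> carrier G" for u
    using assms that by (simp flip: m_assoc)
  note canc = this
  show ?thesis
    using assms by (simp add: m_ac canc)
qed

text \<open>Each quotient \<open>u/u'\<close> is \<open>(u v)(w v)\<^sup>-\<^sup>1(w v')(u' v')\<^sup>-\<^sup>1\<close> for every path \<open>u v w v' u'\<close>, so it is
  written in many ways through four elements of \<open>S\<close>. Different quotients and different paths give different
  quadruples.\<close>

lemma balog_szemeredi_gowers:
  assumes U: "U \<subseteq> carrier G" "finite U" and V: "V \<subseteq> carrier G" "finite V" "V \<noteq> {}" and \<delta>: "\<delta> \<ge> 0"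
    and dense: "\<delta> * real (card U) * real (card V) \<le> real (card {(u, v). u \<in> U \<and> v \<in> V \<and> E u v})"
    and S: "finite S" "\<And>u v. u \<in> U \<Longrightarrow> v \<in> V \<Longrightarrow> E u v \<Longrightarrow> u \<otimes> v \<in> S"
  obtains U' where "U' \<subseteq> U" "\<delta> / 4 * real (card U) \<le> real (card U')"
    "real (card (quot_set G U' U')) * (\<delta> ^ 5 / 1024 * real (card U) * (real (card V))\<^sup>2) \<le> real (card S) ^ 4"
proof (rule dense_bipartite_paths[OF U(2) V(2,3) \<delta> dense])
  fix U' assume U': "U' \<subseteq> U" "\<delta> / 4 * real (card U) \<le> real (card U')" and paths:
    "\<And>u u'. u \<in> U' \<Longrightarrow> u' \<in> U' \<Longrightarrow> \<delta> ^ 5 / 1024 * real (card U) * (real (card V))\<^sup>2 \<le>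
      real (card {(w, v, v'). w \<in> U \<and> v \<in> V \<and> v' \<in> V \<and> E u v \<and> E w v \<and> E w v' \<and> E u' v'})"
  let ?P = "\<lambda>u u'. {(w, v, v'). w \<in> U \<and> v \<in> V \<and> v' \<in> V \<and> E u v \<and> E w v \<and> E w v' \<and> E u' v'}"
  let ?D = "quot_set G U' U'"
  obtain f g where f: "\<And>d. d \<in> ?D \<Longrightarrow> f d \<in> U'" and g: "\<And>d. d \<in> ?D \<Longrightarrow> g d \<in> U'"
    and fg: "\<And>d. d \<in> ?D \<Longrightarrow> f d \<otimes> inv (g d) = d"
    by (rule quot_set_choice[of G U' U']) (rule that; blast)
  let ?X = "SIGMA d:?D. ?P (f d) (g d)"
  let ?F = "\<lambda>(d, w, v, v'). (f d \<otimes> v, w \<otimes> v, w \<otimes> v', g d \<otimes> v')"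
  let ?r = "\<lambda>(a, b, c, e). (a \<otimes> inv b) \<otimes> (c \<otimes> inv e)"
  have carU: "u \<in> carrier G" if "u \<in> U" for u using that U by auto
  have carV: "v \<in> carrier G" if "v \<in> V" for v using that V by auto
  have fU: "f d \<in> U" "g d \<in> U" if "d \<in> ?D" for d using f[OF that] g[OF that] U' by auto
  have r: "?r (?F (d, w, v, v')) = d" if "(d, w, v, v') \<in> ?X" for d w v v'
  proof -
    have c: "f d \<in> carrier G" "g d \<in> carrier G" "w \<in> carrier G" "v \<in> carrier G" "v' \<in> carrier G"
      and d: "d \<in> ?D"
      using that fU carU carV by auto
    have "?r (?F (d, w, v, v')) = (f d \<otimes> inv w) \<otimes> (w \<otimes> inv (g d))"
      using c by (simp add: mult_inv_cancel_right)
    also have "\<dots> = d"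
      using c fg[OF d] by (simp add: mult_inv_trans)
    finally show ?thesis .
  qed
  have inj: "inj_on ?F ?X"
  proof (rule inj_onI)
    fix x y assume "x \<in> ?X" "y \<in> ?X" "?F x = ?F y"
    moreover obtain d w v v' where xe: "x = (d, w, v, v')" by (metis prod_cases4)
    moreover obtain d2 w2 v2 v2' where ye: "y = (d2, w2, v2, v2')" by (metis prod_cases4)
    ultimately have x: "d \<in> ?D" "w \<in> U" "v \<in> V" "v' \<in> V" "d2 \<in> ?D" "w2 \<in> U" "v2 \<in> V" "v2' \<in> V"
      "E (f d) v" "E w v" "E w v'" "E (g d) v'" "E (f d2) v2" "E w2 v2" "E w2 v2'" "E (g d2) v2'"
      and eq: "f d \<otimes> v = f d2 \<otimes> v2" "w \<otimes> v = w2 \<otimes> v2" "w \<otimes> v' = w2 \<otimes> v2'" "g d \<otimes> v' = g d2 \<otimes> v2'"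
      by auto
    have "d = ?r (?F (d, w, v, v'))" using x by (intro r[symmetric]) auto
    also have "\<dots> = ?r (?F (d2, w2, v2, v2'))" using eq by simp
    also have "\<dots> = d2" using x by (intro r) auto
    finally have d: "d = d2" .
    have "v = v2" using eq(1) x fU carU carV unfolding d by (metis Units_eq Units_l_cancel)
    moreover have "v' = v2'" using eq(4) x fU carU carV unfolding d by (metis Units_eq Units_l_cancel)
    moreover have "w = w2" using eq(2) x carU carV unfolding \<open>v = v2\<close> by (metis right_cancel)
    ultimately show "x = y" using d xe ye by simp
  qed
  have img: "?F ` ?X \<subseteq> S \<times> S \<times> S \<times> S"
    using S(2) fU by auto
  have finD: "finite ?D" using finite_subset[OF U'(1) U(2)] by simp
  have finP: "finite (?P a b)" for a b
    by (rule finite_subset[of _ "U \<times> V \<times> V"]) (use U V in auto)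
  let ?T = "\<delta> ^ 5 / 1024 * real (card U) * (real (card V))\<^sup>2"
  have "real (card ?D) * ?T = (\<Sum>d\<in>?D. ?T)" by simp
  also have "\<dots> \<le> (\<Sum>d\<in>?D. real (card (?P (f d) (g d))))"
    using f g paths by (intro sum_mono) auto
  also have "\<dots> = real (card ?X)"
    using finD finP by (subst card_SigmaI) auto
  also have "\<dots> \<le> real (card (S \<times> S \<times> S \<times> S))"
    using S(1) by (intro of_nat_mono card_inj_on_le[OF inj img]) auto
  also have "\<dots> = real (card S) ^ 4"
    by (simp add: card_cartesian_product numeral_eq_Suc)
  finally show thesis by (rule that[OF U'])
qed

end

section \<open>A sum-product estimate in prime fields\<close>

lemma (in comm_group) set_mult_right_comm:
  assumes "A \<subseteq> carrier G" "B \<subseteq> carrier G" "C \<subseteq> carrier G"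
  shows "A <#> B <#> C = A <#> C <#> B"
  using set_mult_assoc[OF assms] set_mult_assoc[OF assms(1,3,2)] set_mult_comm[OF assms(2,3)] by simp

text \<open>Every residue is reached from \<open>0\<close> by adding \<open>1\<close>. This rules out proper subfields, which have few sums and
  few products.\<close>

lemma (in residues_prime) prime_field_induct:
  assumes "\<zero> \<in> S" "\<And>x. x \<in> carrier R \<Longrightarrow> x \<in> S \<Longrightarrow> x \<oplus> \<one> \<in> S"
  shows "carrier R \<subseteq> S"
proof -
  have "int n < int p \<Longrightarrow> int n \<in> S" for n
  proof (induction n)
    case 0
    then show ?case using assms(1) by (simp add: res_zero_eq)
  next
    case (Suc n)
    then have "int n \<in> carrier R" "int n \<in> S" by (auto simp: res_carrier_eq)
    then have "int n \<oplus> \<one> \<in> S" by (rule assms(2))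
    then show ?case using Suc.prems by (simp add: res_add_eq res_one_eq add.commute)
  qed
  note nat_in = this
  show ?thesis
  proof
    fix x assume "x \<in> carrier R"
    then have "0 \<le> x" "x < int p" by (simp_all add: res_carrier_eq)
    then show "x \<in> S" using nat_in[of "nat x"] by simp
  qed
qed

context residues_prime
begin

lemma card_carrier: "card (carrier R) = p"
  by (simp add: res_carrier_eq)

lemma card_dilate:
  assumes "a \<in> carrier R" "a \<noteq> \<zero>" "H \<subseteq> carrier R"
  shows "card ((\<lambda>h. a \<otimes> h) ` H) = card H"
proof (intro card_image inj_onI)
  fix x y assume "x \<in> H" "y \<in> H" "a \<otimes> x = a \<otimes> y"
  then show "x = y"
    using m_lcancel[OF assms(2,1), of x y] assms(3) by auto
qed

text \<open>Dilation commutes with taking differences.\<close>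

lemma card_quot_set_dilate:
  assumes "a \<in> carrier R" "H \<subseteq> carrier R" "finite H"
  shows "card (quot_set (add_monoid R) ((\<lambda>h. a \<otimes> h) ` H) ((\<lambda>h. a \<otimes> h) ` H))
    \<le> card (quot_set (add_monoid R) H H)"
proof -
  have dist: "a \<otimes> x \<oplus> \<ominus> (a \<otimes> y) = a \<otimes> (x \<oplus> \<ominus> y)" if "x \<in> H" "y \<in> H" for x y
  proof -
    have "x \<in> carrier R" "y \<in> carrier R" using that assms by auto
    then show ?thesis using assms(1) by (simp add: r_distr r_minus)
  qed
  have "quot_set (add_monoid R) ((\<lambda>h. a \<otimes> h) ` H) ((\<lambda>h. a \<otimes> h) ` H)
      \<subseteq> (\<lambda>h. a \<otimes> h) ` quot_set (add_monoid R) H H"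
  proof
    fix z assume "z \<in> quot_set (add_monoid R) ((\<lambda>h. a \<otimes> h) ` H) ((\<lambda>h. a \<otimes> h) ` H)"
    then obtain x y where xy: "x \<in> H" "y \<in> H" "z = a \<otimes> x \<oplus> \<ominus> (a \<otimes> y)"
      unfolding quot_set_def a_inv_def[symmetric] by auto
    have "x \<oplus> \<ominus> y \<in> quot_set (add_monoid R) H H"
      using xy(1,2) unfolding quot_set_def a_inv_def[symmetric] by auto
    then show "z \<in> (\<lambda>h. a \<otimes> h) ` quot_set (add_monoid R) H H"
      unfolding xy(3) dist[OF xy(1,2)] by (rule imageI)
  qed
  then have "card (quot_set (add_monoid R) ((\<lambda>h. a \<otimes> h) ` H) ((\<lambda>h. a \<otimes> h) ` H))
      \<le> card ((\<lambda>h. a \<otimes> h) ` quot_set (add_monoid R) H H)"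
    using assms by (intro card_mono) auto
  also have "\<dots> \<le> card (quot_set (add_monoid R) H H)"
    using assms by (intro card_image_le) auto
  finally show ?thesis .
qed

text \<open>Count the collisions \<open>x + \<xi> y = x' + \<xi> y'\<close> over all \<open>\<xi>\<close> at once. Those with \<open>y = y'\<close> are the \<open>m\<^sup>2\<close>
  trivial ones for each \<open>\<xi>\<close>, and a quadruple with \<open>y \<noteq> y'\<close> occurs for at most one \<open>\<xi>\<close>. As \<open>m\<^sup>2 \<le> p\<close>, an
  average \<open>\<xi>\<close> has at most \<open>2 m\<^sup>2\<close> collisions.\<close>

lemma exists_ratio_few_collisions:
  assumes H: "H \<subseteq> carrier R" "H \<noteq> {}" and small: "(card H)\<^sup>2 \<le> p"
  obtains \<xi> where "\<xi> \<in> carrier R" "(card H)\<^sup>2 \<le> 2 * card ((\<lambda>(x, y). x \<oplus> \<xi> \<otimes> y) ` (H \<times> H))"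
proof -
  have finH: "finite H" using H finite finite_subset by blast
  define m where "m = card H"
  have m: "m > 0" using H finH by (simp add: m_def card_gt_0_iff)
  define Col where "Col \<xi> = {(z, z'). z \<in> H \<times> H \<and> z' \<in> H \<times> H \<and>
    (case z of (x, y) \<Rightarrow> x \<oplus> \<xi> \<otimes> y) = (case z' of (x, y) \<Rightarrow> x \<oplus> \<xi> \<otimes> y)}" for \<xi>
  have finCol: "finite (Col \<xi>)" for \<xi>
    by (rule finite_subset[of _ "(H \<times> H) \<times> (H \<times> H)"]) (use finH in \<open>auto simp: Col_def\<close>)
  define X where "X = (SIGMA \<xi>:carrier R. Col \<xi>)"
  define D where "D = (\<lambda>z. (z, z)) ` (H \<times> H)"
  define Rest where "Rest = {(\<xi>, (x, y), (x', y')) | \<xi> x y x' y'. \<xi> \<in> carrier R \<and>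
    x \<in> H \<and> y \<in> H \<and> x' \<in> H \<and> y' \<in> H \<and> y \<noteq> y' \<and> x \<oplus> \<xi> \<otimes> y = x' \<oplus> \<xi> \<otimes> y'}"
  have carH: "h \<in> carrier R" if "h \<in> H" for h using that H by auto
  have "X \<subseteq> carrier R \<times> D \<union> Rest"
  proof
    fix q assume q: "q \<in> X"
    obtain \<xi> x y x' y' where qe: "q = (\<xi>, (x, y), (x', y'))" by (metis prod.exhaust)
    have h: "\<xi> \<in> carrier R" "x \<in> H" "y \<in> H" "x' \<in> H" "y' \<in> H" "x \<oplus> \<xi> \<otimes> y = x' \<oplus> \<xi> \<otimes> y'"
      using q by (auto simp: qe X_def Col_def)
    show "q \<in> carrier R \<times> D \<union> Rest"
    proof (cases "y = y'")
      case True
      then have "x = x'" using h carH by (metis add.right_cancel m_closed)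
      then show ?thesis using True h by (auto simp: qe D_def)
    qed (use h qe in \<open>auto simp: Rest_def\<close>)
  qed
  moreover have finRest: "finite Rest"
    by (rule finite_subset[of _ "carrier R \<times> (H \<times> H) \<times> (H \<times> H)"]) (use finH finite in \<open>auto simp: Rest_def\<close>)
  ultimately have "card X \<le> card (carrier R \<times> D \<union> Rest)"
    using finH finite by (intro card_mono) (auto simp: D_def)
  also have "\<dots> \<le> card (carrier R \<times> D) + card Rest"
    by (rule card_Un_le)
  also have "card (carrier R \<times> D) = p * m\<^sup>2"
  proof -
    have "card D = card (H \<times> H)"
      unfolding D_def by (intro card_image inj_onI) auto
    then show ?thesis
      by (simp add: card_cartesian_product card_carrier m_def power2_eq_square)
  qed
  also have "card Rest \<le> m ^ 4"
  proof -
    have "inj_on snd Rest"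
    proof (rule inj_onI)
      fix q r assume *: "q \<in> Rest" "r \<in> Rest" "snd q = snd r"
      obtain \<xi> x y x' y' where q: "q = (\<xi>, (x, y), (x', y'))" by (metis prod.exhaust)
      obtain \<eta> z where "r = (\<eta>, z)" by (metis prod.exhaust)
      with * q have r: "r = (\<eta>, (x, y), (x', y'))" by simp
      have h: "\<xi> \<in> carrier R" "\<eta> \<in> carrier R" "x \<in> H" "y \<in> H" "x' \<in> H" "y' \<in> H" "y \<noteq> y'"
        "x \<oplus> \<xi> \<otimes> y = x' \<oplus> \<xi> \<otimes> y'" "x \<oplus> \<eta> \<otimes> y = x' \<oplus> \<eta> \<otimes> y'"
        using *(1,2) unfolding Rest_def q r by simp_all
      have c: "x \<in> carrier R" "y \<in> carrier R" "x' \<in> carrier R" "y' \<in> carrier R"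
        using h carH by auto
      have solve: "\<zeta> \<otimes> (y \<ominus> y') = x' \<ominus> x" if "\<zeta> \<in> carrier R" "x \<oplus> \<zeta> \<otimes> y = x' \<oplus> \<zeta> \<otimes> y'" for \<zeta>
      proof -
        have "\<zeta> \<otimes> (y \<ominus> y') = (x \<oplus> \<zeta> \<otimes> y) \<ominus> x \<ominus> \<zeta> \<otimes> y'"
          using that(1) c by algebra
        also have "\<dots> = x' \<ominus> x" unfolding that(2) using that(1) c by algebra
        finally show ?thesis .
      qed
      have "y \<ominus> y' \<noteq> \<zero>" using h c by simp
      moreover have "\<xi> \<otimes> (y \<ominus> y') = \<eta> \<otimes> (y \<ominus> y')"
        using solve[OF h(1,8)] solve[OF h(2,9)] by simp
      ultimately have "\<xi> = \<eta>" using c h by (metis m_rcancel minus_closed)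
      then show "q = r" using q r by simp
    qed
    moreover have "snd ` Rest \<subseteq> (H \<times> H) \<times> (H \<times> H)"
      by (auto simp: Rest_def)
    ultimately have "card Rest \<le> card ((H \<times> H) \<times> (H \<times> H))"
      using finH by (intro card_inj_on_le) auto
    then show ?thesis by (simp add: card_cartesian_product m_def numeral_eq_Suc mult.assoc)
  qed
  finally have X_le: "card X \<le> p * m\<^sup>2 + m ^ 4" by simp
  have "m ^ 4 \<le> p * m\<^sup>2"
    using small mult_right_mono[of "m\<^sup>2" p "m\<^sup>2"] by (simp add: m_def numeral_eq_Suc)
  with X_le have X_le': "card X \<le> p * (2 * m\<^sup>2)" by simp
  have "\<exists>\<xi>\<in>carrier R. card (Col \<xi>) \<le> 2 * m\<^sup>2"
  proof (rule ccontr)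
    assume "\<not> ?thesis"
    then have "(\<Sum>\<xi>\<in>carrier R. 2 * m\<^sup>2) < (\<Sum>\<xi>\<in>carrier R. card (Col \<xi>))"
      using finite by (intro sum_strict_mono) auto
    also have "\<dots> = card X"
      using finite finCol by (simp add: X_def)
    finally show False using X_le' by (simp add: card_carrier)
  qed
  then obtain \<xi> where \<xi>: "\<xi> \<in> carrier R" "card (Col \<xi>) \<le> 2 * m\<^sup>2" by blast
  let ?im = "(\<lambda>(x, y). x \<oplus> \<xi> \<otimes> y) ` (H \<times> H)"
  have "(card (H \<times> H))\<^sup>2 \<le> card ?im * card (Col \<xi>)"
    unfolding Col_def by (rule card_squared_le_collisions) (use finH in auto)
  also have "\<dots> \<le> card ?im * (2 * m\<^sup>2)"
    using \<xi>(2) by simp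
  finally have "m\<^sup>2 * m\<^sup>2 \<le> (2 * card ?im) * m\<^sup>2"
    by (simp add: card_cartesian_product m_def power2_eq_square mult_ac)
  then have "m\<^sup>2 \<le> 2 * card ?im"
    using m by (metis mult_le_cancel2 zero_less_power)
  then show thesis using that \<xi>(1) by (simp add: m_def)
qed

text \<open>\<open>Q\<close> is the set of quotients \<open>(a - b)/(c - d)\<close>. If \<open>\<eta> \<notin> Q\<close> then all sums \<open>x + \<eta> y\<close> are distinct.
  It is enough to find a \<open>\<xi> \<in> Q\<close> for which \<open>\<eta> = \<xi> + 1\<close> has few collisions, because multiplying \<open>x + (\<xi> + 1) y\<close>
  by \<open>c - d\<close> then gives the stated combination. If \<open>Q\<close> is everything, any \<open>\<eta>\<close> with few collisions will do; otherwise
  \<open>Q\<close> contains some \<open>\<xi>\<close> with \<open>\<xi> + 1 \<notin> Q\<close>.\<close>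

lemma exists_spreading_combination:
  assumes H: "H \<subseteq> carrier R" "2 \<le> card H" and small: "(card H)\<^sup>2 \<le> p"
  obtains a b c d where "a \<in> H" "b \<in> H" "c \<in> H" "d \<in> H"
    "(card H)\<^sup>2 \<le> 2 * card ((\<lambda>(x, y). (c \<ominus> d) \<otimes> x \<oplus> ((a \<ominus> b) \<oplus> (c \<ominus> d)) \<otimes> y) ` (H \<times> H))"
proof -
  define Q where "Q = {\<xi> \<in> carrier R. \<exists>a\<in>H. \<exists>b\<in>H. \<exists>c\<in>H. \<exists>d\<in>H. c \<noteq> d \<and> \<xi> \<otimes> (c \<ominus> d) = a \<ominus> b}"
  have carH: "h \<in> carrier R" if "h \<in> H" for h using that H by auto
  have finH: "finite H" and neH: "H \<noteq> {}" using H by (auto intro: card_ge_0_finite)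
  obtain \<xi> where \<xi>: "\<xi> \<in> carrier R" "\<xi> \<oplus> \<one> \<in> carrier R" "\<xi> \<in> Q"
    and big: "(card H)\<^sup>2 \<le> 2 * card ((\<lambda>(x, y). x \<oplus> (\<xi> \<oplus> \<one>) \<otimes> y) ` (H \<times> H))"
  proof (cases "carrier R \<subseteq> Q")
    case True
    obtain \<eta> where \<eta>: "\<eta> \<in> carrier R" "(card H)\<^sup>2 \<le> 2 * card ((\<lambda>(x, y). x \<oplus> \<eta> \<otimes> y) ` (H \<times> H))"
      using exists_ratio_few_collisions[OF H(1) neH small] by metis
    have "(\<eta> \<ominus> \<one>) \<oplus> \<one> = \<eta>" using \<eta>(1) one_closed by algebra
    moreover have "\<eta> \<ominus> \<one> \<in> Q" using \<eta>(1) True by auto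
    ultimately show thesis using that[of "\<eta> \<ominus> \<one>"] \<eta> by simp
  next
    case False
    obtain c d where cd: "c \<in> H" "d \<in> H" "c \<noteq> d"
      using H(2) by (metis card_le_Suc0_iff_eq finH not_less_eq_eq numeral_2_eq_2)
    have "\<zero> \<otimes> (c \<ominus> d) = c \<ominus> c" using cd carH by (simp add: minus_eq r_neg)
    then have "\<zero> \<in> Q" using cd by (auto simp: Q_def)
    then obtain \<xi> where \<xi>: "\<xi> \<in> carrier R" "\<xi> \<in> Q" "\<xi> \<oplus> \<one> \<notin> Q"
      using prime_field_induct[of Q] False by blast
    have "inj_on (\<lambda>(x, y). x \<oplus> (\<xi> \<oplus> \<one>) \<otimes> y) (H \<times> H)"
    proof (rule inj_onI, clarify)
      fix x y x' y' assume h: "x \<in> H" "y \<in> H" "x' \<in> H" "y' \<in> H"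
        and eq: "x \<oplus> (\<xi> \<oplus> \<one>) \<otimes> y = x' \<oplus> (\<xi> \<oplus> \<one>) \<otimes> y'"
      have c: "x \<in> carrier R" "y \<in> carrier R" "x' \<in> carrier R" "y' \<in> carrier R" "\<xi> \<oplus> \<one> \<in> carrier R"
        using h carH \<xi> by auto
      have yy: "y = y'"
      proof (rule ccontr)
        assume ne: "y \<noteq> y'"
        have "(\<xi> \<oplus> \<one>) \<otimes> (y \<ominus> y') = (x \<oplus> (\<xi> \<oplus> \<one>) \<otimes> y) \<ominus> x \<ominus> (\<xi> \<oplus> \<one>) \<otimes> y'"
          using c \<xi>(1) one_closed by algebra
        also have "\<dots> = x' \<ominus> x" unfolding eq using c \<xi>(1) one_closed by algebra
        finally have "\<xi> \<oplus> \<one> \<in> Q" using c(5) h ne unfolding Q_def by blast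
        then show False using \<xi>(3) by simp
      qed
      moreover have "x = x'" using eq c unfolding yy by (metis add.right_cancel m_closed)
      ultimately show "x = x' \<and> y = y'" by simp
    qed
    then have "card ((\<lambda>(x, y). x \<oplus> (\<xi> \<oplus> \<one>) \<otimes> y) ` (H \<times> H)) = (card H)\<^sup>2"
      by (simp add: card_image card_cartesian_product power2_eq_square)
    then show thesis using that[of \<xi>] \<xi> by simp
  qed
  from \<xi>(3) obtain a b c d where h: "a \<in> H" "b \<in> H" "c \<in> H" "d \<in> H" "c \<noteq> d" "\<xi> \<otimes> (c \<ominus> d) = a \<ominus> b"
    by (auto simp: Q_def)
  have car: "a \<in> carrier R" "b \<in> carrier R" "c \<in> carrier R" "d \<in> carrier R" using h carH by auto
  have nz: "c \<ominus> d \<noteq> \<zero>" using h car by simp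
  let ?im = "(\<lambda>(x, y). x \<oplus> (\<xi> \<oplus> \<one>) \<otimes> y) ` (H \<times> H)"
  have lin: "(c \<ominus> d) \<otimes> x \<oplus> ((a \<ominus> b) \<oplus> (c \<ominus> d)) \<otimes> y = (c \<ominus> d) \<otimes> (x \<oplus> (\<xi> \<oplus> \<one>) \<otimes> y)"
    if "x \<in> H" "y \<in> H" for x y
    unfolding h(6)[symmetric] using car carH[OF that(1)] carH[OF that(2)] \<xi>(1) one_closed by algebra
  have "(\<lambda>(x, y). (c \<ominus> d) \<otimes> x \<oplus> ((a \<ominus> b) \<oplus> (c \<ominus> d)) \<otimes> y) ` (H \<times> H)
      = (\<lambda>u. (c \<ominus> d) \<otimes> u) ` ?im"
    unfolding image_image
  proof (rule image_cong[OF refl])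
    fix z assume "z \<in> H \<times> H"
    then obtain x y where "z = (x, y)" "x \<in> H" "y \<in> H" by blast
    then show "(case z of (x, y) \<Rightarrow> (c \<ominus> d) \<otimes> x \<oplus> ((a \<ominus> b) \<oplus> (c \<ominus> d)) \<otimes> y)
        = (c \<ominus> d) \<otimes> (case z of (x, y) \<Rightarrow> x \<oplus> (\<xi> \<oplus> \<one>) \<otimes> y)"
      using lin by simp
  qed
  moreover have "card ((\<lambda>u. (c \<ominus> d) \<otimes> u) ` ?im) = card ?im"
    using nz car \<xi>(2) H(1) by (intro card_dilate) auto
  ultimately show thesis using that[OF h(1-4)] big by simp
qed

abbreviation sumset :: "int set \<Rightarrow> int set \<Rightarrow> int set" (infixl \<open>\<boxplus>\<close> 60) where
  "A \<boxplus> B \<equiv> A <#>\<^bsub>add_monoid R\<^esub> B"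

text \<open>
  The set \<open>H1\<close> consists of the \<open>a\<close> whose dilate \<open>a H\<close> meets the pivot dilate \<open>e H\<close> in at least \<open>n/(2L)\<close>
  points; multiplicative energy makes it large for a suitable \<open>e\<close>. The spreading combination expands to
  \<open>(c x + c y + a y) - (d x + d y + b y)\<close>. The triangle inequality with pivot \<open>e H\<close> reduces its image to two
  sums of four dilates, and exchanging the dilates for \<open>e H\<close> one by one bounds these by the fourfold sum of \<open>e H\<close>.
\<close>

lemma sum_product:
  assumes H: "H \<subseteq> carrier R - {\<zero>}" "H \<noteq> {}" and small: "(card H)\<^sup>2 \<le> p"
    and L_sum: "real (card (quot_set (add_monoid R) H H)) \<le> L * real (card H)"
    and L_prod: "real (card (H <#> H)) \<le> L * real (card H)"
  shows "real (card H) \<le> 512 * L ^ 22"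
proof -
  have H': "H \<subseteq> carrier R" using H by auto
  have finH: "finite H" using H' finite finite_subset by blast
  have carH: "h \<in> carrier R" "h \<noteq> \<zero>" if "h \<in> H" for h using that H by auto
  define n where "n = real (card H)"
  have n: "n > 0" using H finH by (simp add: n_def card_gt_0_iff)
  define dil where "dil a = (\<lambda>h. a \<otimes> h) ` H" for a
  have dil: "dil a \<subseteq> carrier R" "finite (dil a)" "card (dil a) = card H" if "a \<in> H" for a
    using carH[OF that] H' finH by (auto simp: dil_def card_dilate)
  have L1: "L \<ge> 1"
  proof -
    obtain h where h: "h \<in> H" using H by auto
    have "card (dil h) \<le> card (H <#> H)"
      using finH h by (intro card_mono) (auto simp: dil_def set_mult_def)
    then have "1 * n \<le> L * n" using L_prod dil[OF h] by (simp add: n_def)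
    then show ?thesis using n by simp
  qed
  \<comment> \<open>A collision \<open>a h = e h'\<close> of products is a common point of the dilates \<open>a H\<close> and \<open>e H\<close>.\<close>
  define I where "I e a = dil a \<inter> dil e" for e a
  have finI: "finite (I e a)" for e a using finH by (simp add: I_def dil_def)
  have energy: "n * (n\<^sup>2 / L) \<le> (\<Sum>e\<in>H. \<Sum>a\<in>H. real (card (I e a)))"
  proof -
    define Col where "Col = {(z, z'). z \<in> H \<times> H \<and> z' \<in> H \<times> H \<and>
      (case z of (x, y) \<Rightarrow> x \<otimes> y) = (case z' of (x, y) \<Rightarrow> x \<otimes> y)}"
    have "(card (H \<times> H))\<^sup>2 \<le> card (H <#> H) * card Col"
      unfolding set_mult_image Col_def by (rule card_squared_le_collisions) (use finH in auto)
    then have "real ((card (H \<times> H))\<^sup>2) \<le> real (card (H <#> H)) * real (card Col)"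
      by (metis of_nat_le_iff of_nat_mult)
    also have "\<dots> \<le> (L * n) * real (card Col)"
      using L_prod by (intro mult_right_mono) (auto simp: n_def)
    finally have "n * (n * n\<^sup>2) \<le> n * (L * real (card Col))"
      by (simp add: card_cartesian_product n_def power2_eq_square mult_ac)
    then have "n * n\<^sup>2 \<le> L * real (card Col)" using n by simp
    then have "n * (n\<^sup>2 / L) \<le> real (card Col)"
      using L1 by (simp add: field_simps)
    also have "\<dots> \<le> real (card (SIGMA e:H. SIGMA a:H. I e a))"
    proof (intro of_nat_mono card_inj_on_le)
      show "inj_on (\<lambda>((a, h), (e, h')). (e, a, a \<otimes> h)) Col"
      proof (rule inj_onI)
        fix q r assume "q \<in> Col" "r \<in> Col"
          "(\<lambda>((a, h), (e, h')). (e, a, a \<otimes> h)) q = (\<lambda>((a, h), (e, h')). (e, a, a \<otimes> h)) r"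
        moreover obtain a h e h' where q: "q = ((a, h), (e, h'))" by (metis prod.exhaust)
        moreover obtain a2 h2 e2 h2' where r: "r = ((a2, h2), (e2, h2'))" by (metis prod.exhaust)
        ultimately have x: "a \<in> H" "h \<in> H" "e \<in> H" "h' \<in> H" "h2 \<in> H" "h2' \<in> H"
          and eq: "a2 = a" "e2 = e" "a \<otimes> h = a \<otimes> h2" "a \<otimes> h = e \<otimes> h'" "a \<otimes> h2 = e \<otimes> h2'"
          by (auto simp: Col_def)
        have "h = h2" using eq(3) x carH m_lcancel by metis
        moreover have "h' = h2'" using eq(3,4,5) x carH m_lcancel by metis
        ultimately show "q = r" using eq q r by simp
      qed
      show "(\<lambda>((a, h), (e, h')). (e, a, a \<otimes> h)) ` Col \<subseteq> (SIGMA e:H. SIGMA a:H. I e a)"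
        by (auto simp: Col_def I_def dil_def)
    qed (use finH finI in auto)
    also have "\<dots> = (\<Sum>e\<in>H. \<Sum>a\<in>H. real (card (I e a)))"
      using finH finI by simp
    finally show ?thesis .
  qed
  obtain e where e: "e \<in> H" "n\<^sup>2 / L \<le> (\<Sum>a\<in>H. real (card (I e a)))"
  proof (rule ccontr)
    assume "\<not> thesis"
    with that have "\<And>e. e \<in> H \<Longrightarrow> (\<Sum>a\<in>H. real (card (I e a))) < n\<^sup>2 / L" by force
    then have "(\<Sum>e\<in>H. \<Sum>a\<in>H. real (card (I e a))) < (\<Sum>e\<in>H. n\<^sup>2 / L)"
      using finH H by (intro sum_strict_mono) auto
    then show False using energy by (simp add: n_def)
  qed
  define H1 where "H1 = {a \<in> H. n / (2 * L) \<le> real (card (I e a))}"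
  have H1: "H1 \<subseteq> H" by (auto simp: H1_def)
  have H1_large: "n / (2 * L) \<le> real (card H1)"
  proof -
    have I_le: "real (card (I e a)) \<le> (if a \<in> H1 then n else 0) + n / (2 * L)" if "a \<in> H" for a
    proof -
      have "card (I e a) \<le> card (dil e)"
        using dil[OF e(1)] by (intro card_mono) (auto simp: I_def)
      then have "real (card (I e a)) \<le> n" using dil[OF e(1)] by (simp add: n_def)
      then show ?thesis using that n L1 by (auto simp: H1_def intro: add_increasing2)
    qed
    have "n\<^sup>2 / L \<le> (\<Sum>a\<in>H. (if a \<in> H1 then n else 0) + n / (2 * L))"
      using e(2) sum_mono[of H, OF I_le] by (rule order_trans)
    also have "\<dots> = real (card H1) * n + n * (n / (2 * L))"
      using finH H1 by (simp add: sum.distrib n_def sum.If_cases Int_absorb1 Int_commute)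
    finally have "n * (n / (2 * L)) \<le> n * real (card H1)"
      by (simp add: power2_eq_square field_simps)
    then show ?thesis using mult_le_cancel_left_pos[OF n] by blast
  qed
  \<comment> \<open>One factor \<open>L\<close> of the exchange comes from the differences of \<open>H\<close>, the factor \<open>2 L\<close> from the size of the overlap.\<close>
  define W where "W = dil e"
  have W: "W \<subseteq> carrier R" "finite W" "card W = card H" "W \<noteq> {}"
    using dil[OF e(1)] H by (auto simp: W_def dil_def)
  let ?M = "2 * L\<^sup>2"
  have exchange: "real (card (P \<boxplus> dil a)) \<le> ?M * real (card (P \<boxplus> W))"
    if a: "a \<in> H1" and P: "P \<subseteq> carrier R" "finite P" for a P
  proof -
    have aH: "a \<in> H" using a H1 by auto
    have "card (P \<boxplus> dil a) * card (dil a \<inter> W)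
        \<le> card (P \<boxplus> W) * card (quot_set (add_monoid R) (dil a) (dil a))"
      using add.card_set_mult_exchange[OF P dil(1,2)[OF aH] W(1,2)] by simp
    also have "\<dots> \<le> card (P \<boxplus> W) * card (quot_set (add_monoid R) H H)"
      using card_quot_set_dilate[of a H] carH[OF aH] H' finH by (intro mult_left_mono) (auto simp: dil_def)
    finally have "real (card (P \<boxplus> dil a)) * real (card (I e a))
        \<le> real (card (P \<boxplus> W)) * real (card (quot_set (add_monoid R) H H))"
      by (simp add: I_def W_def flip: of_nat_mult)
    also have "\<dots> \<le> real (card (P \<boxplus> W)) * (L * n)"
      using L_sum by (intro mult_left_mono) (auto simp: n_def)
    finally have "real (card (P \<boxplus> dil a)) * real (card (I e a)) \<le> real (card (P \<boxplus> W)) * (L * n)" .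
    moreover have "real (card (P \<boxplus> dil a)) * (n / (2 * L)) \<le> real (card (P \<boxplus> dil a)) * real (card (I e a))"
      using a by (intro mult_left_mono) (auto simp: H1_def)
    ultimately have "real (card (P \<boxplus> dil a)) * (n / (2 * L)) \<le> real (card (P \<boxplus> W)) * (L * n)"
      by linarith
    then have "n * real (card (P \<boxplus> dil a)) \<le> n * (?M * real (card (P \<boxplus> W)))"
      using L1 by (simp add: field_simps power2_eq_square)
    then show ?thesis using n by simp
  qed
  have sum_closed: "A \<boxplus> B \<subseteq> carrier R" if "A \<subseteq> carrier R" "B \<subseteq> carrier R" for A B
    using add.set_mult_closed[OF that] by simp
  have sum_mem: "x \<oplus> y \<in> A \<boxplus> B" if "x \<in> A" "y \<in> B" for x y A B
    using that by (auto simp: set_mult_def)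
  have sum_finite: "finite (A \<boxplus> B)" if "finite A" "finite B" for A B :: "int set"
    using that by simp
  have right_comm: "A \<boxplus> B \<boxplus> C = A \<boxplus> C \<boxplus> B"
    if "A \<subseteq> carrier R" "B \<subseteq> carrier R" "C \<subseteq> carrier R" for A B C
    using add.set_mult_right_comm[OF that] by simp
  have comm: "A \<boxplus> B = B \<boxplus> A" if "A \<subseteq> carrier R" "B \<subseteq> carrier R" for A B
    using add.set_mult_comm[OF that] by simp
  have fourW: "real (card (W \<boxplus> W \<boxplus> W \<boxplus> W)) \<le> L ^ 4 * n"
  proof -
    have "card (quot_set (add_monoid R) W W) \<le> card (quot_set (add_monoid R) H H)"
      unfolding W_def dil_def using e(1) carH H' finH by (intro card_quot_set_dilate) auto
    then have "real (card (quot_set (add_monoid R) W W)) \<le> L * real (card W)"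
      using L_sum W by simp
    then show ?thesis
      using add.card_fourfold_le[OF W(1,2,4), of L] W(3) by (simp add: n_def)
  qed
  have triple: "real (card (dil a \<boxplus> dil b \<boxplus> dil c \<boxplus> W)) \<le> ?M ^ 3 * (L ^ 4 * n)"
    if "a \<in> H1" "b \<in> H1" "c \<in> H1" for a b c
  proof -
    have abc: "a \<in> H" "b \<in> H" "c \<in> H" using that H1 by auto
    note cl = dil(1)[OF abc(1)] dil(1)[OF abc(2)] dil(1)[OF abc(3)] W(1)
    note fn = dil(2)[OF abc(1)] dil(2)[OF abc(2)] dil(2)[OF abc(3)] W(2)
    have M0: "?M \<ge> 0" by simp
    have "dil a \<boxplus> dil b \<boxplus> dil c \<boxplus> W = dil a \<boxplus> dil b \<boxplus> W \<boxplus> dil c"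
      using cl by (intro right_comm sum_closed) auto
    then have "real (card (dil a \<boxplus> dil b \<boxplus> dil c \<boxplus> W)) \<le> ?M * real (card (dil a \<boxplus> dil b \<boxplus> W \<boxplus> W))"
      using cl fn that by (simp only:, intro exchange sum_closed sum_finite) auto
    also have "dil a \<boxplus> dil b \<boxplus> W \<boxplus> W = dil a \<boxplus> W \<boxplus> W \<boxplus> dil b"
      using right_comm[OF cl(1,2,4)] right_comm[OF sum_closed[OF cl(1,4)] cl(2,4)] by metis
    also have "?M * real (card (dil a \<boxplus> W \<boxplus> W \<boxplus> dil b)) \<le> ?M * (?M * real (card (dil a \<boxplus> W \<boxplus> W \<boxplus> W)))"
      using cl fn that by (intro mult_left_mono[OF _ M0] exchange sum_closed sum_finite) auto
    also have "dil a \<boxplus> W \<boxplus> W \<boxplus> W = W \<boxplus> W \<boxplus> W \<boxplus> dil a"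
      using comm[OF cl(1,4)] right_comm[OF cl(4,1,4)] right_comm[OF sum_closed[OF cl(4,4)] cl(1,4)]
      by metis
    also have "?M * (?M * real (card (W \<boxplus> W \<boxplus> W \<boxplus> dil a))) \<le> ?M * (?M * (?M * real (card (W \<boxplus> W \<boxplus> W \<boxplus> W))))"
      using cl fn that by (intro mult_left_mono[OF _ M0] exchange sum_closed sum_finite) auto
    also have "\<dots> \<le> ?M * (?M * (?M * (L ^ 4 * n)))"
      by (intro mult_left_mono[OF _ M0] fourW)
    finally show ?thesis by (simp only: power3_eq_cube mult.assoc)
  qed
  show ?thesis
  proof (cases "2 \<le> card H1")
    case False
    then have "n / (2 * L) \<le> 1" using H1_large by linarith
    then have "n \<le> 2 * L" using L1 by (simp add: field_simps)
    also have "\<dots> \<le> 512 * L ^ 22"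
      using self_le_power[of L 22] L1 by simp
    finally show ?thesis by (simp add: n_def)
  next
    case True
    have H1': "H1 \<subseteq> carrier R" using H1 H' by auto
    have finH1: "finite H1" using H1 finH finite_subset by blast
    have "(card H1)\<^sup>2 \<le> (card H)\<^sup>2"
      using H1 finH by (intro power_mono card_mono) auto
    then have "(card H1)\<^sup>2 \<le> p" using small by (rule order_trans)
    then obtain a b c d where h: "a \<in> H1" "b \<in> H1" "c \<in> H1" "d \<in> H1" and
      big: "(card H1)\<^sup>2 \<le> 2 * card ((\<lambda>(x, y). (c \<ominus> d) \<otimes> x \<oplus> ((a \<ominus> b) \<oplus> (c \<ominus> d)) \<otimes> y) ` (H1 \<times> H1))"
      using exists_spreading_combination[OF H1' True] by metis
    let ?im = "(\<lambda>(x, y). (c \<ominus> d) \<otimes> x \<oplus> ((a \<ominus> b) \<oplus> (c \<ominus> d)) \<otimes> y) ` (H1 \<times> H1)"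
    let ?U = "dil c \<boxplus> dil c \<boxplus> dil a" and ?V = "dil d \<boxplus> dil d \<boxplus> dil b"
    have abcd: "a \<in> H" "b \<in> H" "c \<in> H" "d \<in> H" using h H1 by auto
    note dcl = dil(1)[OF abcd(1)] dil(1)[OF abcd(2)] dil(1)[OF abcd(3)] dil(1)[OF abcd(4)]
    note dfn = dil(2)[OF abcd(1)] dil(2)[OF abcd(2)] dil(2)[OF abcd(3)] dil(2)[OF abcd(4)]
    have UV: "?U \<subseteq> carrier R" "?V \<subseteq> carrier R" "finite ?U" "finite ?V"
      by (intro sum_closed sum_finite dcl dfn)+
    have dil_mem: "u \<otimes> h \<in> dil u" if "h \<in> H1" for u h
      using that H1 by (auto simp: dil_def)
    have "?im \<subseteq> quot_set (add_monoid R) ?U ?V"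
    proof
      fix z assume "z \<in> ?im"
      then obtain x y where xy: "x \<in> H1" "y \<in> H1"
        and z: "z = (c \<ominus> d) \<otimes> x \<oplus> ((a \<ominus> b) \<oplus> (c \<ominus> d)) \<otimes> y" by auto
      have "(c \<ominus> d) \<otimes> x \<oplus> ((a \<ominus> b) \<oplus> (c \<ominus> d)) \<otimes> y
          = (c \<otimes> x \<oplus> c \<otimes> y \<oplus> a \<otimes> y) \<oplus> \<ominus> (d \<otimes> x \<oplus> d \<otimes> y \<oplus> b \<otimes> y)"
        using carH(1)[OF abcd(1)] carH(1)[OF abcd(2)] carH(1)[OF abcd(3)] carH(1)[OF abcd(4)]
          subsetD[OF H1' xy(1)] subsetD[OF H1' xy(2)] by algebra
      moreover have "c \<otimes> x \<oplus> c \<otimes> y \<oplus> a \<otimes> y \<in> ?U" "d \<otimes> x \<oplus> d \<otimes> y \<oplus> b \<otimes> y \<in> ?V"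
        by (intro sum_mem dil_mem xy)+
      ultimately show "z \<in> quot_set (add_monoid R) ?U ?V"
        unfolding z quot_set_def a_inv_def[symmetric] by auto
    qed
    then have "card ?im \<le> card (quot_set (add_monoid R) ?U ?V)"
      using UV by (intro card_mono) auto
    then have "card ?im * card W \<le> card (quot_set (add_monoid R) ?U ?V) * card W" by simp
    also have "\<dots> \<le> card (?U \<boxplus> W) * card (?V \<boxplus> W)"
      using add.ruzsa_triangle[OF UV(1,2) W(1) UV(3,4) W(2)] by simp
    finally have "real (card ?im) * n \<le> real (card (?U \<boxplus> W)) * real (card (?V \<boxplus> W))"
      by (simp add: n_def W(3) flip: of_nat_mult)
    also have "\<dots> \<le> (?M ^ 3 * (L ^ 4 * n)) * (?M ^ 3 * (L ^ 4 * n))"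
      using triple h n by (intro mult_mono) auto
    also have "?M ^ 3 * (L ^ 4 * n) = 8 * L ^ 10 * n"
      by (simp add: power_mult_distrib flip: power_mult power_add)
    also have "(8 * L ^ 10 * n) * (8 * L ^ 10 * n) = (64 * L ^ 20 * n) * n"
      by (simp flip: power_add)
    finally have im_le: "real (card ?im) \<le> 64 * L ^ 20 * n" using n by simp
    have "(n / (2 * L))\<^sup>2 \<le> (real (card H1))\<^sup>2"
      using H1_large n L1 by (intro power_mono) auto
    also have "\<dots> \<le> 2 * real (card ?im)"
      using big by (metis of_nat_le_iff of_nat_mult of_nat_numeral of_nat_power)
    also have "\<dots> \<le> 128 * L ^ 20 * n" using im_le by linarith
    finally have "(n / (2 * L))\<^sup>2 * (2 * L)\<^sup>2 \<le> 128 * L ^ 20 * n * (2 * L)\<^sup>2"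
      by (intro mult_right_mono) auto
    also have "(n / (2 * L))\<^sup>2 * (2 * L)\<^sup>2 = n * n"
      using L1 by (simp add: power_divide power2_eq_square)
    also have "128 * L ^ 20 * n * (2 * L)\<^sup>2 = n * (512 * L ^ 22)"
      by (simp add: power_mult_distrib flip: power_add)
    finally have "n * n \<le> n * (512 * L ^ 22)" .
    then show ?thesis using n by (simp add: n_def)
  qed
qed

end

section \<open>The expander\<close>

context residues_prime
begin

lemma comm_group_mult_of: "comm_group (mult_of R)"
  using units_comm_group by (simp add: mult_of_is_Units)

lemma set_mult_mult_of: "A <#>\<^bsub>mult_of R\<^esub> B = A <#> B"
  by (simp add: set_mult_def)

lemma inv_nonzero: "x \<in> carrier R \<Longrightarrow> x \<noteq> \<zero> \<Longrightarrow> inv x \<in> carrier R \<and> inv x \<noteq> \<zero> \<and> x \<otimes> inv x = \<one>"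
  using Units_inv_Units Units_r_inv field_Units by auto

lemma quot_set_mult_of:
  assumes "B \<subseteq> carrier R - {\<zero>}"
  shows "quot_set (mult_of R) A B = {a \<otimes> inv b | a b. a \<in> A \<and> b \<in> B}"
proof -
  have "inv\<^bsub>mult_of R\<^esub> b = inv b" if "b \<in> B" for b
    using that assms by (intro m_inv_mult_of) auto
  then show ?thesis by (simp add: quot_set_def) metis
qed

text \<open>Dividing by a fixed element turns these into cube roots of unity.\<close>

lemma card_equal_cubes_le:
  assumes "F \<subseteq> carrier R - {\<zero>}" "\<And>x y. x \<in> F \<Longrightarrow> y \<in> F \<Longrightarrow> x \<otimes> x \<otimes> x = y \<otimes> y \<otimes> y"
  shows "card F \<le> 3"
proof (cases "F = {}")
  case False
  then obtain y where y: "y \<in> F" by auto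
  have yc: "y \<in> carrier R" "y \<noteq> \<zero>" using y assms(1) by auto
  define i where "i = inv y"
  have i: "i \<in> carrier R" "i \<noteq> \<zero>" "y \<otimes> i = \<one>" using inv_nonzero[OF yc] by (auto simp: i_def)
  have "inj_on (\<lambda>x. i \<otimes> x) F"
  proof (rule inj_onI)
    fix x x' assume "x \<in> F" "x' \<in> F" "i \<otimes> x = i \<otimes> x'"
    then show "x = x'" using m_lcancel[OF i(2,1), of x x'] assms(1) by auto
  qed
  moreover have "(\<lambda>x. i \<otimes> x) ` F \<subseteq> {x \<in> carrier R. x [^] (3::nat) = \<one>}"
  proof clarify
    fix x assume x: "x \<in> F"
    have xc: "x \<in> carrier R" using x assms(1) by auto
    have "(i \<otimes> x) [^] (3::nat) = i \<otimes> i \<otimes> i \<otimes> (x \<otimes> x \<otimes> x)"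
      using i(1) xc by (simp add: numeral_3_eq_3 nat_pow_Suc m_ac)
    also have "x \<otimes> x \<otimes> x = y \<otimes> y \<otimes> y" using assms(2)[OF x y] .
    also have "i \<otimes> i \<otimes> i \<otimes> (y \<otimes> y \<otimes> y) = (y \<otimes> i) \<otimes> (y \<otimes> i) \<otimes> (y \<otimes> i)"
      using i(1) yc(1) by (simp add: m_ac)
    also have "\<dots> = \<one>" using i(3) by simp
    finally show "i \<otimes> x \<in> carrier R \<and> (i \<otimes> x) [^] (3::nat) = \<one>" using i(1) xc by simp
  qed
  ultimately have "card F \<le> card {x \<in> carrier R. x [^] (3::nat) = \<one>}"
    using finite by (intro card_inj_on_le) auto
  also have "\<dots> \<le> 3" by (rule num_roots_le_deg) (use finite in auto)
  finally show ?thesis .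
qed simp

text \<open>
  The size \<open>|A|\<close> is bounded by a power of \<open>K\<close>, so \<open>K\<close> is at least a power of \<open>|A|\<close>. With \<open>\<tau> = |T|\<close> and
  \<open>v = |V|\<close>, the graph that joins \<open>u\<close> to all \<open>u t\<close> with \<open>t \<in> T\<close> has density \<open>\<delta> = \<tau>/v\<close>, which is at least
  \<open>1/(6 K\<^sup>7)\<close>. The set \<open>H\<close> that comes out then has at least \<open>N/(24 K\<^sup>7)\<close> elements and satisfies the
  hypotheses of \<open>sum_product\<close> with \<open>L = 2^28 K^52\<close>. The exponent of \<open>K\<close> is \<open>1151 = 7 + 22 \<cdot> 52\<close>.
\<close>

lemma card_le_expander:
  assumes A: "A \<subseteq> carrier R - {\<zero>}" "A \<noteq> {}" and B: "B \<subseteq> carrier R - {\<zero>}" "B \<noteq> {}"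
    and small: "(card A)\<^sup>2 \<le> p"
    and K_A: "real (card (A <#> B)) \<le> K * real (card A)"
    and K_B: "real (card (A <#> B)) \<le> K * real (card B)"
    and K_f: "real (card (image2 (poly_f R) A B)) \<le> K * real (card A)"
  shows "real (card A) \<le> 2 ^ 630 * K ^ 1151"
proof -
  interpret mul: comm_group "mult_of R" by (rule comm_group_mult_of)
  have carM: "carrier (mult_of R) = carrier R - {\<zero>}" by simp
  have fin: "finite A" "finite B" using A B finite finite_subset by (metis Diff_subset subset_trans)+
  have carA: "a \<in> carrier R" "a \<noteq> \<zero>" if "a \<in> A" for a using that A by auto
  have carB: "x \<in> carrier R" "x \<noteq> \<zero>" if "x \<in> B" for x using that B by auto
  define N b where "N = real (card A)" and "b = real (card B)"
  have N: "N > 0" and b: "b > 0" using A B fin by (auto simp: N_def b_def card_gt_0_iff)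
  have AM: "A \<subseteq> carrier (mult_of R)" and BM: "B \<subseteq> carrier (mult_of R)" using A B by auto
  have A_le: "card A \<le> card (A <#> B)"
    using mul.card_le_card_set_mult[OF AM BM fin B(2)] by (simp add: set_mult_mult_of)
  have "1 * N \<le> K * N" using A_le K_A by (simp add: N_def)
  then have K: "K \<ge> 1" using N by simp
  have NKb: "N \<le> K * b" using A_le K_B by (simp add: N_def b_def)
  show ?thesis
  proof (cases "2 \<le> card B")
    case False
    then have "b \<le> 1" by (simp add: b_def)
    then have "N \<le> K * 1" using NKb K by (meson mult_left_mono order_trans zero_le_one)
    also have "\<dots> \<le> K ^ 1151" using K self_le_power[of K 1151] by simp
    also have "\<dots> \<le> 2 ^ 630 * K ^ 1151"
      using K mult_right_mono[of 1 "2 ^ 630 :: real" "K ^ 1151"] by simp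
    finally show ?thesis by (simp add: N_def)
  next
    case True
    \<comment> \<open>Pairs with \<open>a + x = 0\<close> are removed: the value \<open>0\<close> may be popular, but its pairs all have the ratio \<open>-1\<close>.\<close>
    define P where "P = {(a, x). a \<in> A \<and> x \<in> B \<and> a \<oplus> x \<noteq> \<zero>}"
    define g where "g = (\<lambda>(a, x). poly_f R a x)"
    have finP: "finite P" by (rule finite_subset[of _ "A \<times> B"]) (use fin in \<open>auto simp: P_def\<close>)
    have P_large: "N * b \<le> 2 * real (card P)"
    proof -
      have "A \<times> B \<subseteq> P \<union> (\<lambda>a. (a, \<ominus> a)) ` A"
      proof clarify
        fix a x assume ax: "a \<in> A" "x \<in> B" "(a, x) \<notin> (\<lambda>a. (a, \<ominus> a)) ` A"
        have "x = \<ominus> a" if "a \<oplus> x = \<zero>"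
          using that carA[OF ax(1)] carB[OF ax(2)] by (metis add.inv_equality add.m_comm)
        then show "(a, x) \<in> P" using ax by (auto simp: P_def)
      qed
      then have "card (A \<times> B) \<le> card (P \<union> (\<lambda>a. (a, \<ominus> a)) ` A)"
        using finP fin by (intro card_mono) auto
      also have "\<dots> \<le> card P + card ((\<lambda>a. (a, \<ominus> a)) ` A)" by (rule card_Un_le)
      also have "\<dots> \<le> card P + card A" using fin by (simp add: card_image_le)
      finally have "real (card A * card B) \<le> real (card P + card A)"
        by (simp only: card_cartesian_product of_nat_le_iff)
      then have "N * b \<le> real (card P) + N" by (simp add: N_def b_def)
      moreover have "N * 2 \<le> N * b" using True N by (intro mult_left_mono) (auto simp: b_def)
      ultimately show ?thesis by linarith
    qed
    have P_ne: "P \<noteq> {}" using P_large N b by (auto simp: mult_le_0_iff)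
    have gP: "real (card (g ` P)) \<le> K * N"
    proof -
      have "g ` P \<subseteq> image2 (poly_f R) A B" by (auto simp: g_def P_def image2_def)
      moreover have "finite (image2 (poly_f R) A B)"
      proof -
        have "image2 (poly_f R) A B = g ` (A \<times> B)" by (auto simp: g_def image2_def)
        then show ?thesis using fin by simp
      qed
      ultimately have "card (g ` P) \<le> card (image2 (poly_f R) A B)" by (rule card_mono[rotated])
      then show ?thesis using K_f by (simp add: N_def)
    qed
    obtain c where c: "c \<in> g ` P" and c_pop: "b \<le> 2 * K * real (card {z \<in> P. g z = c})"
    proof (rule ccontr)
      assume "\<not> thesis"
      with that have lt: "2 * K * real (card {z \<in> P. g z = c}) < b" if "c \<in> g ` P" for c
        using that by force
      have "2 * K * real (card P) = (\<Sum>c\<in>g ` P. 2 * K * real (card {z \<in> P. g z = c}))"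
        using card_eq_sum_fibres[OF finP, of g] by (simp add: sum_distrib_left)
      also have "\<dots> < (\<Sum>c\<in>g ` P. b)"
        using finP P_ne lt by (intro sum_strict_mono) auto
      also have "\<dots> = real (card (g ` P)) * b" by simp
      also have "\<dots> \<le> (K * N) * b" using gP b by (intro mult_right_mono) auto
      finally have "K * (2 * real (card P)) < K * (N * b)" by (simp add: mult_ac)
      then show False using P_large K by simp
    qed
    define Pc where "Pc = {z \<in> P. g z = c}"
    have Pc: "a \<in> A" "x \<in> B" "a \<oplus> x \<noteq> \<zero>" "a \<otimes> x \<otimes> (a \<oplus> x) = c" if "(a, x) \<in> Pc" for a x
      using that by (auto simp: Pc_def P_def g_def poly_f_def)
    have c0: "c \<noteq> \<zero>" "c \<in> carrier R"
    proof -
      obtain a x where "(a, x) \<in> P" "g (a, x) = c" using c by auto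
      then have ax: "(a, x) \<in> Pc" by (simp add: Pc_def)
      show "c \<noteq> \<zero>" "c \<in> carrier R"
        unfolding Pc(4)[OF ax, symmetric] using Pc(1-3)[OF ax] carA carB by (auto simp: integral_iff)
    qed
    have finPc: "finite Pc" using finP by (simp add: Pc_def)
    define rat where "rat = (\<lambda>(a, x). x \<otimes> inv a)"
    define T where "T = rat ` Pc"
    have finT: "finite T" using finPc by (simp add: T_def)
    \<comment> \<open>With \<open>x = a t\<close> the equation \<open>f(a, x) = c\<close> reads \<open>a\<^sup>3 t (1 + t) = c\<close>, so equal ratios force equal cubes.\<close>
    have T_mult: "card Pc \<le> 3 * card T"
    proof -
      have "card {z \<in> Pc. rat z = t} \<le> 3" if "t \<in> T" for t
      proof -
        let ?F = "{z \<in> Pc. rat z = t}"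
        have xt: "x = a \<otimes> t" "t \<in> carrier R" if "(a, x) \<in> ?F" for a x
        proof -
          have ax: "a \<in> carrier R" "x \<in> carrier R" "a \<noteq> \<zero>" "t = x \<otimes> inv a"
            using that carA[OF Pc(1)] carB[OF Pc(2)] by (auto simp: rat_def)
          have i: "inv a \<in> carrier R" "a \<otimes> inv a = \<one>" using inv_nonzero ax by auto
          show "t \<in> carrier R" using ax i by simp
          have "a \<otimes> t = x \<otimes> (a \<otimes> inv a)" using ax i(1) by (simp add: m_ac)
          then show "x = a \<otimes> t" using i ax by simp
        qed
        have val: "(a \<otimes> a \<otimes> a) \<otimes> (t \<otimes> (\<one> \<oplus> t)) = c" if "(a, x) \<in> ?F" for a x
        proof -
          have a: "a \<in> carrier R" using that carA[OF Pc(1)] by auto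
          have "a \<otimes> x \<otimes> (a \<oplus> x) = (a \<otimes> a \<otimes> a) \<otimes> (t \<otimes> (\<one> \<oplus> t))"
            unfolding xt(1)[OF that] using a xt(2)[OF that] one_closed by algebra
          then show ?thesis using Pc(4) that by auto
        qed
        have "inj_on fst ?F"
        proof (rule inj_onI)
          fix y z assume yz: "y \<in> ?F" "z \<in> ?F" "fst y = fst z"
          have "snd y = fst y \<otimes> t" "snd z = fst z \<otimes> t"
            using xt(1)[of "fst y" "snd y"] xt(1)[of "fst z" "snd z"] yz(1,2) by simp_all
          then show "y = z" using yz(3) by (simp add: prod_eq_iff)
        qed
        then have "card ?F = card (fst ` ?F)" by (simp add: card_image)
        also have "\<dots> \<le> 3"
        proof (rule card_equal_cubes_le)
          show "fst ` ?F \<subseteq> carrier R - {\<zero>}" using carA[OF Pc(1)] by auto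
          fix a a' assume "a \<in> fst ` ?F" "a' \<in> fst ` ?F"
          then obtain x x' where h: "(a, x) \<in> ?F" "(a', x') \<in> ?F" by force
          have ac: "a \<in> carrier R" "a' \<in> carrier R" "t \<in> carrier R"
            using h carA[OF Pc(1)] xt(2)[OF h(1)] by auto
          have "t \<otimes> (\<one> \<oplus> t) \<noteq> \<zero>" using val[OF h(1)] c0 ac by (metis m_closed r_null)
          moreover have "(a \<otimes> a \<otimes> a) \<otimes> (t \<otimes> (\<one> \<oplus> t)) = (a' \<otimes> a' \<otimes> a') \<otimes> (t \<otimes> (\<one> \<oplus> t))"
            using val[OF h(1)] val[OF h(2)] by simp
          ultimately show "a \<otimes> a \<otimes> a = a' \<otimes> a' \<otimes> a'"
            using ac m_rcancel[of "t \<otimes> (\<one> \<oplus> t)" "a \<otimes> a \<otimes> a" "a' \<otimes> a' \<otimes> a'"] by simp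
        qed
        finally show ?thesis .
      qed
      then have "(\<Sum>t\<in>T. card {z \<in> Pc. rat z = t}) \<le> (\<Sum>t\<in>T. 3)" by (intro sum_mono)
      then show ?thesis
        using card_eq_sum_fibres[OF finPc, of rat] by (simp add: T_def)
    qed
    have T_nz: "t \<in> carrier R" "t \<noteq> \<zero>" if "t \<in> T" for t
    proof -
      obtain a x where ax: "(a, x) \<in> Pc" "t = x \<otimes> inv a" using \<open>t \<in> T\<close> by (auto simp: T_def rat_def)
      have "inv a \<in> carrier R \<and> inv a \<noteq> \<zero>" using inv_nonzero carA[OF Pc(1)[OF ax(1)]] by simp
      then show "t \<in> carrier R" "t \<noteq> \<zero>" using carB[OF Pc(2)[OF ax(1)]] by (auto simp: ax(2) integral_iff)
    qed
    have T_large: "N \<le> 6 * K\<^sup>2 * real (card T)"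
    proof -
      have "b \<le> 2 * K * real (card Pc)" using c_pop by (simp add: Pc_def)
      also have "\<dots> \<le> 2 * K * (3 * real (card T))"
        using T_mult K by (intro mult_left_mono) auto
      finally have "K * b \<le> K * (2 * K * (3 * real (card T)))" using K by (intro mult_left_mono) auto
      then show ?thesis using NKb by (simp add: power2_eq_square)
    qed
    \<comment> \<open>\<open>D\<close> bounds the vertex set \<open>A B / A\<close>, the set of sums along the edges, and \<open>A A\<close>.\<close>
    define D where "D = quot_set (mult_of R) (A <#> A <#> B) A"
    have D_le: "real (card D) \<le> K ^ 5 * N"
      using mul.card_quot_set_le[OF AM fin(1) A(2) BM fin(2) B(2), of K] K_A K_B
      by (simp add: D_def N_def set_mult_mult_of)
    have finD: "finite D" using fin by (simp add: D_def)
    have D_mem: "a \<otimes> a' \<otimes> x \<otimes> inv u \<in> D" if "a \<in> A" "a' \<in> A" "x \<in> B" "u \<in> A" for a a' x u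
      unfolding D_def quot_set_mult_of[OF A(1)] using that by (force simp: set_mult_def)
    have clM: "X <#> Y \<subseteq> carrier (mult_of R)" if "X \<subseteq> carrier (mult_of R)" "Y \<subseteq> carrier (mult_of R)" for X Y
      using mul.set_mult_closed[OF that] by (simp only: set_mult_mult_of)
    have AA_le: "card (A <#> A) \<le> card D" and AB_le: "card (quot_set (mult_of R) (A <#> B) A) \<le> card D"
    proof -
      let ?I = "(\<lambda>a. inv\<^bsub>mult_of R\<^esub> a) ` A"
      have I: "?I \<subseteq> carrier (mult_of R)" "finite ?I" "?I \<noteq> {}"
        using mul.inv_image_closed[OF AM] fin A by auto
      have D_eq: "D = A <#> A <#> B <#> ?I"
        by (simp only: D_def mul.quot_set_eq_set_mult set_mult_mult_of)
      have le: "card X \<le> card (X <#> Y)"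
        if "X \<subseteq> carrier (mult_of R)" "Y \<subseteq> carrier (mult_of R)" "finite X" "finite Y" "Y \<noteq> {}" for X Y
        using mul.card_le_card_set_mult[OF that] by (simp only: set_mult_mult_of)
      have "card (A <#> A) \<le> card (A <#> A <#> B)"
        using fin B by (intro le clM AM BM) auto
      also have "\<dots> \<le> card D"
        unfolding D_eq using fin I by (intro le clM AM BM) auto
      finally show "card (A <#> A) \<le> card D" .
      have Q: "quot_set (mult_of R) (A <#> B) A = A <#> B <#> ?I"
        by (simp only: mul.quot_set_eq_set_mult set_mult_mult_of)
      have "card (A <#> B <#> ?I) \<le> card (A <#> B <#> ?I <#> A)"
        using fin I A by (intro le clM AM BM) auto
      also have "A <#> B <#> ?I <#> A = D"
      proof -
        have "A <#> B <#> ?I <#> A = A <#> (A <#> B <#> ?I)"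
          using mul.set_mult_comm[OF clM[OF clM[OF AM BM] I(1)] AM] by (simp only: set_mult_mult_of)
        also have "\<dots> = A <#> (A <#> B) <#> ?I"
          using mul.set_mult_assoc[OF AM clM[OF AM BM] I(1)] by (simp only: set_mult_mult_of)
        also have "A <#> (A <#> B) = A <#> A <#> B"
          using mul.set_mult_assoc[OF AM AM BM] by (simp only: set_mult_mult_of)
        finally show ?thesis by (simp only: D_eq)
      qed
      finally show "card (quot_set (mult_of R) (A <#> B) A) \<le> card D" by (simp only: Q)
    qed
    define V where "V = quot_set (mult_of R) (A <#> B) A"
    define E where "E u v \<longleftrightarrow> (\<exists>t\<in>T. v = u \<otimes> t)" for u v
    define S where "S = (\<lambda>w. c \<otimes> inv w) ` D"
    have V_eq: "V = {a \<otimes> inv b | a b. a \<in> A <#> B \<and> b \<in> A}"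
      unfolding V_def by (rule quot_set_mult_of[OF A(1)])
    have UT: "u \<otimes> t \<in> V" if ut: "u \<in> A" "t \<in> T" for u t
    proof -
      obtain a x where ax: "(a, x) \<in> Pc" "t = x \<otimes> inv a" using ut by (auto simp: T_def rat_def)
      have "inv a \<in> carrier R" using inv_nonzero carA[OF Pc(1)[OF ax(1)]] by simp
      then have "u \<otimes> t = u \<otimes> x \<otimes> inv a"
        using ax carA[OF ut(1)] carB[OF Pc(2)[OF ax(1)]] by (simp add: m_assoc)
      moreover have "u \<otimes> x \<in> A <#> B" using ut Pc(2)[OF ax(1)] by (auto simp: set_mult_def)
      ultimately show ?thesis unfolding V_eq using Pc(1)[OF ax(1)] by blast
    qed
    have V: "V \<subseteq> carrier R" "finite V"
      using mul.quot_set_closed[OF clM[OF AM BM] AM] fin by (auto simp: V_def)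
    have T_pos: "real (card T) > 0" using T_large N K by (cases "card T = 0") auto
    have V_ne: "V \<noteq> {}" using UT A(2) T_pos by (metis all_not_in_conv card.empty less_irrefl of_nat_0)
    have v_pos: "real (card V) > 0" using V V_ne by (simp add: card_gt_0_iff)
    have v_le: "real (card V) \<le> K ^ 5 * N" using AB_le D_le by (simp add: V_def)
    have edges: "card A * card T \<le> card {(u, v). u \<in> A \<and> v \<in> V \<and> E u v}"
    proof -
      have "inj_on (\<lambda>(u, t). (u, u \<otimes> t)) (A \<times> T)"
      proof (rule inj_onI)
        fix y z assume yz: "y \<in> A \<times> T" "z \<in> A \<times> T"
          "(\<lambda>(u, t). (u, u \<otimes> t)) y = (\<lambda>(u, t). (u, u \<otimes> t)) z"
        obtain u t u' t' where y: "y = (u, t)" and z: "z = (u', t')" by (metis prod.exhaust)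
        have h: "u \<in> A" "t \<in> T" "t' \<in> T" "u' = u" "u \<otimes> t = u \<otimes> t'" using yz y z by auto
        then have "t = t'" using m_lcancel[OF carA(2,1)[OF h(1)], of t t'] T_nz by simp
        then show "y = z" using y z h(4) by simp
      qed
      moreover have "(\<lambda>(u, t). (u, u \<otimes> t)) ` (A \<times> T) \<subseteq> {(u, v). u \<in> A \<and> v \<in> V \<and> E u v}"
        using UT by (auto simp: E_def)
      moreover have "finite {(u, v). u \<in> A \<and> v \<in> V \<and> E u v}"
        by (rule finite_subset[of _ "A \<times> V"]) (use fin V in auto)
      ultimately have "card (A \<times> T) \<le> card {(u, v). u \<in> A \<and> v \<in> V \<and> E u v}"
        by (rule card_inj_on_le)
      then show ?thesis by (simp add: card_cartesian_product)
    qed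
    have sums: "u \<oplus> v \<in> S" if uv: "u \<in> A" "v \<in> V" "E u v" for u v
    proof -
      obtain a x where ax: "(a, x) \<in> Pc" "v = u \<otimes> (x \<otimes> inv a)"
        using uv(3) by (auto simp: E_def T_def rat_def)
      note m = Pc[OF ax(1)]
      define ia iu where "ia = inv a" and "iu = inv u"
      have i: "ia \<in> carrier R" "ia \<noteq> \<zero>" "a \<otimes> ia = \<one>" "iu \<in> carrier R" "iu \<noteq> \<zero>" "u \<otimes> iu = \<one>"
        using inv_nonzero[OF carA[OF m(1)]] inv_nonzero[OF carA[OF uv(1)]] by (auto simp: ia_def iu_def)
      note cr = carA[OF m(1)] carB[OF m(2)] carA[OF uv(1)]
      let ?w = "a \<otimes> a \<otimes> x \<otimes> iu"
      have w: "?w \<in> carrier R" "?w \<noteq> \<zero>" using cr i by (auto simp: integral_iff)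
      \<comment> \<open>\<open>u + u x/a = (u/a)(a + x)\<close>, and \<open>a + x = c/(a x)\<close> on the popular fibre\<close>
      have "(u \<oplus> u \<otimes> (x \<otimes> ia)) \<otimes> ?w = (u \<otimes> iu) \<otimes> (a \<otimes> x \<otimes> (a \<oplus> x \<otimes> (a \<otimes> ia)))"
        using cr i(1,4) by algebra
      also have "\<dots> = c" using i cr m(4) c0(2) by simp
      finally have "(u \<oplus> v) \<otimes> ?w = c" by (simp only: ax(2) ia_def)
      moreover have "inv ?w \<in> carrier R" "?w \<otimes> inv ?w = \<one>" using inv_nonzero[OF w] by auto
      moreover have "u \<oplus> v \<in> carrier R" using cr V uv(2) by auto
      ultimately have "u \<oplus> v = c \<otimes> inv ?w"
        using w by (metis m_assoc r_one)
      moreover have "?w \<in> D" unfolding iu_def using D_mem[OF m(1) m(1) m(2) uv(1)] .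
      ultimately show ?thesis by (auto simp: S_def)
    qed
    have finS: "finite S" using finD by (simp add: S_def)
    have S_le: "real (card S) \<le> K ^ 5 * N"
      using card_image_le[OF finD, of "\<lambda>w. c \<otimes> inv w"] D_le by (simp add: S_def)
    define \<tau> v where "\<tau> = real (card T)" and "v = real (card V)"
    define \<delta> where "\<delta> = \<tau> / v"
    have \<delta>0: "\<delta> \<ge> 0" by (simp add: \<delta>_def \<tau>_def v_def)
    have dense: "\<delta> * real (card A) * real (card V) \<le> real (card {(u, v). u \<in> A \<and> v \<in> V \<and> E u v})"
    proof -
      have "\<delta> * real (card A) * real (card V) = real (card A * card T)"
        using v_pos by (simp add: \<delta>_def \<tau>_def v_def)
      then show ?thesis using edges by (simp only: of_nat_le_iff)
    qed
    have A': "A \<subseteq> carrier R" using A by auto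
    show ?thesis
    proof (rule add.balog_szemeredi_gowers[OF A' fin(1) V V_ne \<delta>0 dense finS sums])
      fix H assume H: "H \<subseteq> A" "\<delta> / 4 * real (card A) \<le> real (card H)"
        and diff: "real (card (quot_set (add_monoid R) H H)) * (\<delta> ^ 5 / 1024 * real (card A) * (real (card V))\<^sup>2)
          \<le> real (card S) ^ 4"
      define q h where "q = real (card (quot_set (add_monoid R) H H))" and "h = real (card H)"
      have q0: "q \<ge> 0" by (simp add: q_def)
      have \<delta>_low: "1 \<le> 6 * K ^ 7 * \<delta>"
      proof -
        have "v * N \<le> K ^ 5 * N * (6 * K\<^sup>2 * \<tau>)"
          using v_le T_large N by (intro mult_mono) (auto simp: v_def \<tau>_def)
        also have "\<dots> = N * (6 * K ^ 7 * \<tau>)" by (simp flip: power_add)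
        finally have "v \<le> 6 * K ^ 7 * \<tau>" using N by (simp add: mult.commute)
        then show ?thesis using v_pos by (simp add: \<delta>_def v_def field_simps)
      qed
      have h_low: "N \<le> 24 * K ^ 7 * h"
      proof -
        have "1 * N \<le> (6 * K ^ 7 * \<delta>) * N" using \<delta>_low N by (intro mult_right_mono) auto
        also have "\<dots> = 24 * K ^ 7 * (\<delta> / 4 * N)" by simp
        also have "\<dots> \<le> 24 * K ^ 7 * h"
          using H(2) K by (intro mult_left_mono) (auto simp: h_def N_def)
        finally show ?thesis by simp
      qed
      have h0: "h > 0"
        using h_low N K by (metis h_def mult_zero_right not_less of_nat_0_le_iff order_le_less)
      \<comment> \<open>\<open>\<delta>\<^sup>5 v\<^sup>2 = \<tau>\<^sup>5/v\<^sup>3\<close> is at least \<open>N\<^sup>2/(6^5 K^25)\<close>, and \<open>7962624 = 1024 \<cdot> 6^5\<close>.\<close>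
      have q_le: "q \<le> 7962624 * K ^ 45 * N"
      proof -
        have "N ^ 5 * v ^ 3 \<le> (6 * K\<^sup>2 * \<tau>) ^ 5 * (K ^ 5 * N) ^ 3"
          using T_large v_le N v_pos by (intro mult_mono power_mono) (auto simp: \<tau>_def v_def)
        also have "\<dots> = 7776 * K ^ 25 * \<tau> ^ 5 * N ^ 3"
          by (simp add: power_mult_distrib flip: power_mult power_add)
        finally have "N ^ 3 * (N\<^sup>2 * v ^ 3) \<le> N ^ 3 * (7776 * K ^ 25 * \<tau> ^ 5)"
          by (simp add: mult_ac flip: power_add)
        then have "N\<^sup>2 * v ^ 3 \<le> 7776 * K ^ 25 * \<tau> ^ 5"
          by (rule mult_left_le_imp_le) (use N in simp)
        moreover have "\<tau> ^ 5 = \<delta> ^ 5 * v\<^sup>2 * v ^ 3"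
        proof -
          have "\<tau> = \<delta> * v" using v_pos by (simp add: \<delta>_def v_def)
          then have "\<tau> ^ 5 = \<delta> ^ 5 * v ^ (2 + 3)" by (simp add: power_mult_distrib)
          then show ?thesis by (simp only: power_add mult.assoc)
        qed
        ultimately have "v ^ 3 * N\<^sup>2 \<le> v ^ 3 * (7776 * K ^ 25 * (\<delta> ^ 5 * v\<^sup>2))" by (simp add: mult_ac)
        then have dv: "N\<^sup>2 \<le> 7776 * K ^ 25 * (\<delta> ^ 5 * v\<^sup>2)"
          by (rule mult_left_le_imp_le) (use v_pos in \<open>simp add: v_def\<close>)
        have "q * N ^ 3 = q * N * N\<^sup>2" by (simp add: power2_eq_square power3_eq_cube)
        also have "\<dots> \<le> q * N * (7776 * K ^ 25 * (\<delta> ^ 5 * v\<^sup>2))"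
          using q0 N dv by (intro mult_left_mono) auto
        also have "\<dots> = 7962624 * K ^ 25 * (q * (\<delta> ^ 5 / 1024 * N * v\<^sup>2))" by simp
        also have "\<dots> \<le> 7962624 * K ^ 25 * (real (card S) ^ 4)"
          using diff K by (intro mult_left_mono) (auto simp: q_def N_def v_def)
        also have "\<dots> \<le> 7962624 * K ^ 25 * (K ^ 5 * N) ^ 4"
          using S_le K by (intro mult_left_mono power_mono) auto
        also have "\<dots> = (7962624 * K ^ 45 * N) * N ^ 3"
        proof -
          have "(K ^ 5 * N) ^ 4 = K ^ 20 * (N * N ^ 3)"
            by (simp add: power_mult_distrib power3_eq_cube power4_eq_xxxx flip: power_mult)
          then show ?thesis by (simp flip: power_add)
        qed
        finally show ?thesis by (rule mult_right_le_imp_le) (use N in simp)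
      qed
      \<comment> \<open>Comparing with \<open>|H|\<close> instead of \<open>N\<close> costs \<open>24 K\<^sup>7\<close>, and \<open>24 \<cdot> 7962624 < 2^28\<close>.\<close>
      let ?L = "2 ^ 28 * K ^ 52"
      have sp: "real (card H) \<le> 512 * ?L ^ 22"
      proof (rule sum_product)
        show "H \<subseteq> carrier R - {\<zero>}" using H(1) A(1) by auto
        show "H \<noteq> {}" using h0 by (auto simp: h_def)
        have "card H \<le> card A" using H(1) fin by (simp add: card_mono)
        then have "(card H)\<^sup>2 \<le> (card A)\<^sup>2" by (rule power_mono) simp
        then show "(card H)\<^sup>2 \<le> p" using small by (rule order_trans)
        have "q \<le> 7962624 * K ^ 45 * (24 * K ^ 7 * h)"
          by (rule order_trans[OF q_le], rule mult_left_mono[OF h_low]) (use K in simp)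
        also have "\<dots> = 191102976 * K ^ 52 * h" by (simp flip: power_add)
        also have "\<dots> \<le> ?L * h" using h0 K by (intro mult_right_mono) auto
        finally show "real (card (quot_set (add_monoid R) H H)) \<le> ?L * real (card H)"
          by (simp only: q_def h_def)
        have "card (H <#> H) \<le> card (A <#> A)"
          using fin mono_set_mult[OF H(1) H(1), of R] by (intro card_mono) auto
        then have "real (card (H <#> H)) \<le> K ^ 5 * N"
          using AA_le D_le by linarith
        also have "\<dots> \<le> K ^ 5 * (24 * K ^ 7 * h)"
          using h_low K by (intro mult_left_mono) auto
        also have "\<dots> = 24 * K ^ 12 * h" by (simp flip: power_add)
        also have "\<dots> \<le> ?L * h"
          using h0 K power_increasing[of 12 52 K] by (intro mult_right_mono mult_mono) auto
        finally show "real (card (H <#> H)) \<le> ?L * real (card H)" by (simp only: h_def)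
      qed
      have "N \<le> 24 * K ^ 7 * (512 * ?L ^ 22)"
      proof (rule order_trans[OF h_low], rule mult_left_mono)
        show "h \<le> 512 * ?L ^ 22" using sp by (simp only: h_def)
        show "0 \<le> 24 * K ^ 7" using K by simp
      qed
      also have "?L ^ 22 = 2 ^ 616 * K ^ 1144"
        unfolding power_mult_distrib power_mult[symmetric] by simp
      also have "24 * K ^ 7 * (512 * (2 ^ 616 * K ^ 1144)) = (24 * 512 * 2 ^ 616) * (K ^ 7 * K ^ 1144)"
        by (simp only: mult_ac)
      also have "K ^ 7 * K ^ 1144 = K ^ 1151"
        unfolding power_add[symmetric] by simp
      also have "(24 * 512 * 2 ^ 616) * K ^ 1151 \<le> 2 ^ 630 * K ^ 1151"
        by (rule mult_right_mono) (use K in simp_all)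
      finally show ?thesis by (simp only: N_def)
    qed
  qed
qed

end

theorem theorem6p4:
  shows "\<exists>\<theta>::real. \<theta> > 0 \<and>
    (\<forall>c\<^sub>1 c\<^sub>2 :: real. 0 < c\<^sub>1 \<and> c\<^sub>1 < c\<^sub>2 \<longrightarrow>
      (\<exists>\<kappa>::real. \<kappa> > 0 \<and>
        (\<forall>(p::nat) A B. prime p \<longrightarrow> A \<subseteq> Fp_star p \<longrightarrow> B \<subseteq> Fp_star p \<longrightarrow>
          real (card A) \<le> real p powr (1/2 - 1/400) \<longrightarrow>
          real (card B) \<le> real p powr (1/2 - 1/400) \<longrightarrow>
          c\<^sub>1 * real (card B) < real (card A) \<longrightarrow>
          real (card A) < c\<^sub>2 * real (card B) \<longrightarrow>
          max (real (card (image2 (poly_f (Fp p)) A B))) (real (card (A <#>\<^bsub>Fp p\<^esub> B)))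
            \<ge> \<kappa> * real (card A) powr (1 + \<theta>))))"
  \<comment> \<open>The choice \<open>\<theta> = 1/1151\<close> turns \<open>K^1151\<close> into a multiple of \<open>|A|\<close>, and \<open>\<kappa>\<close> makes the multiple smaller than \<open>2^-630\<close>.\<close>
proof (rule exI[of _ "1/1151 :: real"], intro conjI allI impI)
  fix c\<^sub>1 c\<^sub>2 :: real
  assume c12: "0 < c\<^sub>1 \<and> c\<^sub>1 < c\<^sub>2"
  define \<kappa> where "\<kappa> = 1 / (2 * max 1 c\<^sub>2)"
  have \<kappa>: "\<kappa> > 0" by (simp add: \<kappa>_def)
  show "\<exists>\<kappa>::real. \<kappa> > 0 \<and>
        (\<forall>(p::nat) A B. prime p \<longrightarrow> A \<subseteq> Fp_star p \<longrightarrow> B \<subseteq> Fp_star p \<longrightarrow>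
          real (card A) \<le> real p powr (1/2 - 1/400) \<longrightarrow>
          real (card B) \<le> real p powr (1/2 - 1/400) \<longrightarrow>
          c\<^sub>1 * real (card B) < real (card A) \<longrightarrow>
          real (card A) < c\<^sub>2 * real (card B) \<longrightarrow>
          max (real (card (image2 (poly_f (Fp p)) A B))) (real (card (A <#>\<^bsub>Fp p\<^esub> B)))
            \<ge> \<kappa> * real (card A) powr (1 + 1/1151))"
  proof (intro exI[of _ \<kappa>] conjI allI impI \<kappa>, rule ccontr)
    fix p :: nat and A B :: "int set"
    assume p: "prime p" and A: "A \<subseteq> Fp_star p" and B: "B \<subseteq> Fp_star p"
      and A_small: "real (card A) \<le> real p powr (1/2 - 1/400)"
      and AB: "c\<^sub>1 * real (card B) < real (card A)" "real (card A) < c\<^sub>2 * real (card B)"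
      and neg: "\<not> max (real (card (image2 (poly_f (Fp p)) A B))) (real (card (A <#>\<^bsub>Fp p\<^esub> B)))
            \<ge> \<kappa> * real (card A) powr (1 + 1/1151)"
    interpret residues_prime p "Fp p" by unfold_locales (rule p)
    define N where "N = real (card A)"
    have "card B \<noteq> 0" using AB(2) by (intro notI) simp
    then have "0 < c\<^sub>1 * real (card B)" using c12 by simp
    then have N: "N > 0" using AB(1) by (simp add: N_def)
    have ne: "A \<noteq> {}" "B \<noteq> {}" using N \<open>card B \<noteq> 0\<close> by (auto simp: N_def)
    define K where "K = max 1 c\<^sub>2 * \<kappa> * N powr (1/1151)"
    have split: "N powr (1 + 1/1151) = N powr (1/1151) * N"
      using N by (subst powr_add) simp
    have small: "(card A)\<^sup>2 \<le> p"
    proof -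
      have "N \<le> real p powr (1/2)"
        using A_small prime_gt_0_nat[OF p] powr_mono[of "1/2 - 1/400" "1/2" "real p"]
        by (simp add: N_def)
      then have "N\<^sup>2 \<le> (real p powr (1/2))\<^sup>2" using N by (intro power_mono) auto
      also have "\<dots> = real p" using prime_gt_0_nat[OF p] by (simp add: powr_half_sqrt)
      finally show ?thesis by (simp add: N_def flip: of_nat_power)
    qed
    have bound: "\<kappa> * N powr (1 + 1/1151) \<le> K * N" "\<kappa> * N powr (1 + 1/1151) \<le> K * real (card B)"
    proof -
      have nn: "0 \<le> \<kappa> * N powr (1/1151)" using \<kappa> by simp
      have "1 * N \<le> max 1 c\<^sub>2 * N" using N by (intro mult_right_mono) auto
      then have "(\<kappa> * N powr (1/1151)) * N \<le> (\<kappa> * N powr (1/1151)) * (max 1 c\<^sub>2 * N)"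
        using nn by (intro mult_left_mono) auto
      then show "\<kappa> * N powr (1 + 1/1151) \<le> K * N" by (simp only: split K_def mult_ac)
      have "c\<^sub>2 * real (card B) \<le> max 1 c\<^sub>2 * real (card B)" by (intro mult_right_mono) auto
      then have "N \<le> max 1 c\<^sub>2 * real (card B)" using AB(2) by (simp only: N_def)
      then have "(\<kappa> * N powr (1/1151)) * N \<le> (\<kappa> * N powr (1/1151)) * (max 1 c\<^sub>2 * real (card B))"
        using nn by (intro mult_left_mono) auto
      then show "\<kappa> * N powr (1 + 1/1151) \<le> K * real (card B)" by (simp only: split K_def mult_ac)
    qed
    have lt: "real (card (image2 (poly_f (Fp p)) A B)) < \<kappa> * N powr (1 + 1/1151)"
      "real (card (A <#>\<^bsub>Fp p\<^esub> B)) < \<kappa> * N powr (1 + 1/1151)"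
      using neg by (auto simp: N_def)
    have "N \<le> 2 ^ 630 * K ^ 1151"
      unfolding N_def
    proof (rule card_le_expander[OF A ne(1) B ne(2) small])
      show "real (card (A <#>\<^bsub>Fp p\<^esub> B)) \<le> K * real (card A)"
        "real (card (A <#>\<^bsub>Fp p\<^esub> B)) \<le> K * real (card B)"
        "real (card (image2 (poly_f (Fp p)) A B)) \<le> K * real (card A)"
        using lt bound by (simp_all add: N_def)
    qed
    also have "K ^ 1151 = (1 / 2) ^ 1151 * N"
    proof -
      have "K = 1 / 2 * N powr (1/1151)" by (simp add: K_def \<kappa>_def)
      then have "K ^ 1151 = (1 / 2) ^ 1151 * (N powr (1/1151)) ^ 1151"
        by (simp only: power_mult_distrib)
      also have "(N powr (1/1151)) ^ 1151 = N"
        using N by (simp flip: powr_realpow add: powr_powr)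
      finally show ?thesis .
    qed
    also have "2 ^ 630 * ((1 / 2) ^ 1151 * N) < N"
    proof -
      have "2 ^ 630 * (1 / 2 :: real) ^ 1151 < 1" by (simp add: power_one_over)
      then have "(2 ^ 630 * (1 / 2 :: real) ^ 1151) * N < 1 * N"
        using N by (intro mult_strict_right_mono)
      then show ?thesis by (simp only: mult.assoc mult_1)
    qed
    finally show False by simp
  qed
qed simp

end
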